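(* Let $k$ be a field and $\mathcal{D}$ a set. Every associative differential algebra $A$ over $k$ with differential operations $\mathcal{D}$ (with $1\neq 0$ in $A$) can be embedded into a simple associative differential algebra over $k$ with differential operations $\mathcal{D}$; that is, there exist a simple $\mathcal{D}$-algebra $\mathcal{A}$ and an injective homomorphism of $\mathcal{D}$-algebras $A\to\mathcal{A}$.
   Context: An associative differential algebra with differential operations $\mathcal{D}$ (a $\mathcal{D}$-algebra) over a field $k$ is an associative unital $k$-algebra $A$ together with, for each $D\in\mathcal{D}$, a $k$-linear map $D:A\to A$ satisfying $D(ab)=D(a)b+aD(b)$ for all $a,b\in A$. The operations in $\mathcal{D}$ are not assumed to commute with one another. Homomorphisms of $\mathcal{D}$-algebras are unital $k$-algebra homomorphisms commuting with every $D\in\mathcal{D}$. A $\mathcal{D}$-algebra is simple if it is nonzero and its only two-sided ideals closed under all $D\in\mathcal{D}$ are $0$ and itself. *)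

theory Defs
  imports "HOL-Algebra.Algebra"
begin

(* The locale algebra of HOL-Algebra requires multiplication to be commutative, so associative
   algebras get their own locale; a scalar has to be movable out of both factors of a product. *)
locale assoc_algebra = module K A + field K + A?: ring A
  for K (structure) and A (structure) +
  assumes smult_mult_left:
      "\<lbrakk>c \<in> carrier K; x \<in> carrier A; y \<in> carrier A\<rbrakk> \<Longrightarrow>
        (c \<odot>\<^bsub>A\<^esub> x) \<otimes>\<^bsub>A\<^esub> y = c \<odot>\<^bsub>A\<^esub> (x \<otimes>\<^bsub>A\<^esub> y)"
    and smult_mult_right:
      "\<lbrakk>c \<in> carrier K; x \<in> carrier A; y \<in> carrier A\<rbrakk> \<Longrightarrow>
        x \<otimes>\<^bsub>A\<^esub> (c \<odot>\<^bsub>A\<^esub> y) = c \<odot>\<^bsub>A\<^esub> (x \<otimes>\<^bsub>A\<^esub> y)"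

(* The operation symbols form a set Ds of elements of 'd, possibly empty; the values of dop at
   symbols outside Ds are irrelevant throughout. *)
record ('k, 'a, 'd) diff_algebra = "('k, 'a) module" +
  dop :: "'d \<Rightarrow> 'a \<Rightarrow> 'a"

locale D_algebra = assoc_algebra K A
  for K :: "('k, 'm) ring_scheme" (structure)
    and Ds :: "'d set"
    and A :: "('k, 'a, 'd, 'n) diff_algebra_scheme" (structure) +
  assumes dop_closed:
      "\<lbrakk>D \<in> Ds; x \<in> carrier A\<rbrakk> \<Longrightarrow> dop A D x \<in> carrier A"
    and dop_add:
      "\<lbrakk>D \<in> Ds; x \<in> carrier A; y \<in> carrier A\<rbrakk> \<Longrightarrow>
        dop A D (x \<oplus>\<^bsub>A\<^esub> y) = dop A D x \<oplus>\<^bsub>A\<^esub> dop A D y"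
    and dop_smult:
      "\<lbrakk>D \<in> Ds; c \<in> carrier K; x \<in> carrier A\<rbrakk> \<Longrightarrow>
        dop A D (c \<odot>\<^bsub>A\<^esub> x) = c \<odot>\<^bsub>A\<^esub> dop A D x"
    and dop_mult:
      "\<lbrakk>D \<in> Ds; x \<in> carrier A; y \<in> carrier A\<rbrakk> \<Longrightarrow>
        dop A D (x \<otimes>\<^bsub>A\<^esub> y) = (dop A D x \<otimes>\<^bsub>A\<^esub> y) \<oplus>\<^bsub>A\<^esub> (x \<otimes>\<^bsub>A\<^esub> dop A D y)"

definition D_hom ::
  "('k, 'm) ring_scheme \<Rightarrow> 'd set \<Rightarrow> ('k, 'a, 'd, 'n) diff_algebra_scheme \<Rightarrow>
    ('k, 'b, 'd, 'p) diff_algebra_scheme \<Rightarrow> ('a \<Rightarrow> 'b) set" where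
  "D_hom K Ds A B =
    {h \<in> ring_hom A B.
      (\<forall>c \<in> carrier K. \<forall>x \<in> carrier A. h (c \<odot>\<^bsub>A\<^esub> x) = c \<odot>\<^bsub>B\<^esub> h x) \<and>
      (\<forall>D \<in> Ds. \<forall>x \<in> carrier A. h (dop A D x) = dop B D (h x))}"

(* The two-sided ideals in question are those of the ring: as the algebra is unital, they are
   automatically closed under scalar multiplication. *)
locale simple_D_algebra = D_algebra K Ds A
  for K (structure) and Ds and A (structure) +
  assumes nonzero: "carrier A \<noteq> {\<zero>\<^bsub>A\<^esub>}"
    and simple: "\<lbrakk>ideal I A; \<And>D x. \<lbrakk>D \<in> Ds; x \<in> I\<rbrakk> \<Longrightarrow> dop A D x \<in> I\<rbrakk> \<Longrightarrow>
        I = {\<zero>\<^bsub>A\<^esub>} \<or> I = carrier A"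

(* HOL cannot quantify existentially over types, so "there is an algebra" is rendered by a fixed
   type of elements that depends only on the given types: sets of words over the disjoint union of
   the type of A and the type of the operation symbols. The carrier of the algebra is an arbitrary
   subset of it. No content is lost or added: the type has cardinality at least
   max(|A|, |Ds|, aleph_0), and (by closing A under the operations and under witnesses for
   simplicity) every simple extension of A contains one of at most that size. *)
type_synonym ('a, 'd) ext = "('a + 'd) list set"

end

theory Submission
  imports Defs
begin

text \<open>
  Let \<open>V\<close> be the direct sum of infinitely many copies of \<open>A\<close>, acted on by \<open>A\<close> and by the operations
  \<open>D\<close> componentwise. The commutators with the operators \<open>D\<close> are derivations of \<open>End\<^sub>K V\<close>, and they
  extend those of \<open>A\<close> by Leibniz' rule. Being inner, they preserve every ideal of \<open>End\<^sub>K V\<close>, so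
  the quotient by a maximal ideal is a simple \<open>D\<close>-algebra. If the copies are indexed by a set at
  least as large as \<open>V\<close>, for instance by the words over \<open>A\<close>, then for \<open>a \<noteq> 0\<close> the image of \<open>a\<close> in
  \<open>V\<close> has the full dimension of \<open>V\<close>; hence \<open>P a Q = 1\<close> for some endomorphisms \<open>P\<close> and \<open>Q\<close>, and no
  proper ideal contains \<open>a\<close>.
\<close>

section \<open>Complements in vector spaces\<close>

text \<open>This supplies the upper bounds for Zorn's lemma: any two elements of the union already
  lie in a common member of the chain.\<close>

lemma (in module) Union_chain_submodule:
  assumes "C \<noteq> {}" and "subset.chain {H. submodule H R M} C"
  shows "submodule (\<Union>C) R M"
proof (rule submoduleI)
  have sub: "submodule H R M" if "H \<in> C" for H
    using assms(2) that unfolding pred_on.chain_def by auto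
  show "\<Union>C \<subseteq> carrier M"
    using submoduleE(1)[OF sub] by blast
  obtain H where "H \<in> C" using assms(1) by blast
  then show "\<zero>\<^bsub>M\<^esub> \<in> \<Union>C"
    using subgroup.one_closed[OF submodule.axioms(1)[OF sub]] by auto
  show "\<ominus>\<^bsub>M\<^esub> x \<in> \<Union>C" if "x \<in> \<Union>C" for x
    using that submoduleE(3)[OF sub] by blast
  show "c \<odot>\<^bsub>M\<^esub> x \<in> \<Union>C" if "c \<in> carrier R" "x \<in> \<Union>C" for c x
    using that submoduleE(4)[OF sub] by blast
  fix x y assume "x \<in> \<Union>C" "y \<in> \<Union>C"
  then obtain H where "H \<in> C" "x \<in> H" "y \<in> H"
    using assms(2) unfolding pred_on.chain_def by blast
  then show "x \<oplus>\<^bsub>M\<^esub> y \<in> \<Union>C"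
    using submoduleE(5)[OF sub] by blast
qed

text \<open>Serves two purposes: enlarging a candidate complement by one vector, and, with
  \<open>H\<close> the zero submodule, showing that a line is a submodule.\<close>

lemma (in module) submodule_add_line:
  assumes "submodule H R M" and x: "x \<in> carrier M"
  shows "submodule {h \<oplus>\<^bsub>M\<^esub> c \<odot>\<^bsub>M\<^esub> x | h c. h \<in> H \<and> c \<in> carrier R} R M"
proof -
  note E = submoduleE[OF assms(1)]
  have Hc: "h \<in> carrier M" if "h \<in> H" for h using E(1) that by blast
  have zero: "\<zero>\<^bsub>M\<^esub> \<in> H"
    using subgroup.one_closed[OF submodule.axioms(1)[OF assms(1)]] by auto
  show ?thesis
  proof (rule submoduleI)
    show "{h \<oplus>\<^bsub>M\<^esub> c \<odot>\<^bsub>M\<^esub> x | h c. h \<in> H \<and> c \<in> carrier R} \<subseteq> carrier M"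
      using Hc x by auto
    show "\<zero>\<^bsub>M\<^esub> \<in> {h \<oplus>\<^bsub>M\<^esub> c \<odot>\<^bsub>M\<^esub> x | h c. h \<in> H \<and> c \<in> carrier R}"
      using zero x by (auto intro!: exI[of _ "\<zero>\<^bsub>M\<^esub>"] exI[of _ "\<zero>"])
  next
    fix y assume "y \<in> {h \<oplus>\<^bsub>M\<^esub> c \<odot>\<^bsub>M\<^esub> x | h c. h \<in> H \<and> c \<in> carrier R}"
    then obtain h c where y: "y = h \<oplus>\<^bsub>M\<^esub> c \<odot>\<^bsub>M\<^esub> x" "h \<in> H" "c \<in> carrier R" by blast
    have "\<ominus>\<^bsub>M\<^esub> y = \<ominus>\<^bsub>M\<^esub> h \<oplus>\<^bsub>M\<^esub> (\<ominus> c) \<odot>\<^bsub>M\<^esub> x"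
      using y Hc x by (simp add: M.minus_add smult_l_minus)
    then show "\<ominus>\<^bsub>M\<^esub> y \<in> {h \<oplus>\<^bsub>M\<^esub> c \<odot>\<^bsub>M\<^esub> x | h c. h \<in> H \<and> c \<in> carrier R}"
      using y E(3) by blast
    show "b \<odot>\<^bsub>M\<^esub> y \<in> {h \<oplus>\<^bsub>M\<^esub> c \<odot>\<^bsub>M\<^esub> x | h c. h \<in> H \<and> c \<in> carrier R}"
      if b: "b \<in> carrier R" for b
    proof -
      have "b \<odot>\<^bsub>M\<^esub> y = b \<odot>\<^bsub>M\<^esub> h \<oplus>\<^bsub>M\<^esub> (b \<otimes> c) \<odot>\<^bsub>M\<^esub> x"
        using y Hc x b by (simp add: smult_r_distr smult_assoc1)
      then show ?thesis using y b E(4) by blast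
    qed
  next
    fix y z assume "y \<in> {h \<oplus>\<^bsub>M\<^esub> c \<odot>\<^bsub>M\<^esub> x | h c. h \<in> H \<and> c \<in> carrier R}"
      "z \<in> {h \<oplus>\<^bsub>M\<^esub> c \<odot>\<^bsub>M\<^esub> x | h c. h \<in> H \<and> c \<in> carrier R}"
    then obtain h c h' c' where y: "y = h \<oplus>\<^bsub>M\<^esub> c \<odot>\<^bsub>M\<^esub> x" "h \<in> H" "c \<in> carrier R"
      and z: "z = h' \<oplus>\<^bsub>M\<^esub> c' \<odot>\<^bsub>M\<^esub> x" "h' \<in> H" "c' \<in> carrier R" by blast
    have "y \<oplus>\<^bsub>M\<^esub> z = (h \<oplus>\<^bsub>M\<^esub> h') \<oplus>\<^bsub>M\<^esub> (c \<oplus> c') \<odot>\<^bsub>M\<^esub> x"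
      using y z Hc x by (simp add: smult_l_distr M.a_ac)
    then show "y \<oplus>\<^bsub>M\<^esub> z \<in> {h \<oplus>\<^bsub>M\<^esub> c \<odot>\<^bsub>M\<^esub> x | h c. h \<in> H \<and> c \<in> carrier R}"
      using y z E(5) by blast
  qed
qed

text \<open>By Zorn's lemma there is a submodule \<open>H\<close> maximal among those that meet
  \<open>U\<close> only in zero. Maximality forces every vector into the sum of \<open>U\<close> and
  \<open>H\<close>, because nonzero scalars can be inverted.\<close>

lemma (in module) submodule_complement:
  assumes "field R" and U: "submodule U R M"
  obtains H where "submodule H R M" and "U \<inter> H = {\<zero>\<^bsub>M\<^esub>}"
    and "\<And>x. x \<in> carrier M \<Longrightarrow> \<exists>u\<in>U. \<exists>h\<in>H. x = u \<oplus>\<^bsub>M\<^esub> h"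
proof -
  interpret field R by fact
  note UE = submoduleE[OF U]
  have Uz: "\<zero>\<^bsub>M\<^esub> \<in> U"
    using subgroup.one_closed[OF submodule.axioms(1)[OF U]] by auto
  define F where "F = {H. submodule H R M \<and> U \<inter> H = {\<zero>\<^bsub>M\<^esub>}}"
  have "submodule {\<zero>\<^bsub>M\<^esub>} R M"
    by (rule submoduleI) auto
  then have ne: "F \<noteq> {}"
    using Uz by (auto simp: F_def)
  have "\<exists>H\<in>F. \<forall>L\<in>F. H \<subseteq> L \<longrightarrow> L = H"
  proof (rule subset_Zorn_nonempty[OF ne])
    fix C assume C: "C \<noteq> {}" "subset.chain F C"
    then have "subset.chain {H. submodule H R M} C"
      unfolding pred_on.chain_def F_def by auto
    then have "submodule (\<Union>C) R M"
      using C(1) Union_chain_submodule by blast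
    moreover have "U \<inter> \<Union>C = {\<zero>\<^bsub>M\<^esub>}"
      using C unfolding pred_on.chain_def F_def by blast
    ultimately show "\<Union>C \<in> F" by (simp add: F_def)
  qed
  then obtain H where HF: "H \<in> F" and HM: "\<forall>L\<in>F. H \<subseteq> L \<longrightarrow> L = H" by (rule bexE)
  have H: "submodule H R M" "U \<inter> H = {\<zero>\<^bsub>M\<^esub>}"
    using HF by (simp_all add: F_def)
  have max: "L = H" if "submodule L R M" "U \<inter> L = {\<zero>\<^bsub>M\<^esub>}" "H \<subseteq> L" for L
    using HM that by (simp add: F_def)
  note HE = submoduleE[OF H(1)]
  have Hz: "\<zero>\<^bsub>M\<^esub> \<in> H" using H(2) by blast
  show thesis
  proof (rule that[OF H])
    fix x assume x: "x \<in> carrier M"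
    define L where "L = {h \<oplus>\<^bsub>M\<^esub> c \<odot>\<^bsub>M\<^esub> x | h c. h \<in> H \<and> c \<in> carrier R}"
    have L: "submodule L R M"
      unfolding L_def by (rule submodule_add_line[OF H(1) x])
    have HX: "h \<in> L" if "h \<in> H" for h
    proof -
      have "h \<in> carrier M" using HE(1) that by blast
      then have "h = h \<oplus>\<^bsub>M\<^esub> \<zero> \<odot>\<^bsub>M\<^esub> x" using x by simp
      then show ?thesis using that unfolding L_def by blast
    qed
    have "\<zero>\<^bsub>M\<^esub> \<oplus>\<^bsub>M\<^esub> \<one> \<odot>\<^bsub>M\<^esub> x \<in> L"
      unfolding L_def using Hz by blast
    then have xX: "x \<in> L" using x by simp
    show "\<exists>u\<in>U. \<exists>h\<in>H. x = u \<oplus>\<^bsub>M\<^esub> h"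
    \<comment> \<open>Adding the line through \<open>x\<close> to \<open>H\<close> gives
      \<open>L\<close>. If \<open>L\<close> still meets \<open>U\<close> trivially, then
      \<open>L = H\<close> and \<open>x\<close> lies in \<open>H\<close>. Otherwise a nonzero
      \<open>u\<close> in \<open>U\<close> has the form \<open>h\<close> plus \<open>c\<close> times
      \<open>x\<close>; here \<open>c\<close> is nonzero, as \<open>u\<close> would lie in
      \<open>H\<close> otherwise, so the equation can be solved for \<open>x\<close>.\<close>
    proof (cases "U \<inter> L = {\<zero>\<^bsub>M\<^esub>}")
      case True
      then have "L = H" using max[OF L True] HX by blast
      then have "x \<in> H" using xX by simp
      then show ?thesis using Uz x by (metis M.l_zero)
    next
      case False
      then obtain u where u: "u \<in> U" "u \<in> L" "u \<noteq> \<zero>\<^bsub>M\<^esub>"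
        using Uz HX[OF Hz] by blast
      then obtain h c where h: "h \<in> H" and c: "c \<in> carrier R" and ueq: "u = h \<oplus>\<^bsub>M\<^esub> c \<odot>\<^bsub>M\<^esub> x"
        unfolding L_def by blast
      have carr: "u \<in> carrier M" "h \<in> carrier M" using u(1) UE(1) h HE(1) by auto
      have "c \<noteq> \<zero>"
      proof
        assume "c = \<zero>"
        then have "u = h" using ueq x carr by simp
        then show False using u h H(2) by blast
      qed
      then have ci: "inv c \<in> carrier R" "inv c \<otimes> c = \<one>"
        using c field_Units by auto
      have "c \<odot>\<^bsub>M\<^esub> x = u \<oplus>\<^bsub>M\<^esub> \<ominus>\<^bsub>M\<^esub> h"
        using ueq carr x c by (simp add: M.a_comm[of h "c \<odot>\<^bsub>M\<^esub> x"] M.a_assoc M.r_neg)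
      then have "inv c \<odot>\<^bsub>M\<^esub> (c \<odot>\<^bsub>M\<^esub> x) = inv c \<odot>\<^bsub>M\<^esub> u \<oplus>\<^bsub>M\<^esub> inv c \<odot>\<^bsub>M\<^esub> (\<ominus>\<^bsub>M\<^esub> h)"
        using ci carr by (simp add: smult_r_distr)
      then have "x = inv c \<odot>\<^bsub>M\<^esub> u \<oplus>\<^bsub>M\<^esub> inv c \<odot>\<^bsub>M\<^esub> (\<ominus>\<^bsub>M\<^esub> h)"
        using ci c x smult_assoc1[of "inv c" c x] by simp
      then show ?thesis
        using UE(4)[OF ci(1) u(1)] HE(4)[OF ci(1) HE(3)[OF h]] by blast
    qed
  qed
qed

text \<open>Rearranging the equation gives one vector, \<open>u\<close> minus \<open>u'\<close> as
  well as \<open>h'\<close> minus \<open>h\<close>, that lies in both submodules and therefore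
  vanishes.\<close>

lemma (in module) complement_unique:
  assumes "submodule U R M" "submodule H R M" "U \<inter> H = {\<zero>\<^bsub>M\<^esub>}"
    and "u \<in> U" "u' \<in> U" "h \<in> H" "h' \<in> H" and eq: "u \<oplus>\<^bsub>M\<^esub> h = u' \<oplus>\<^bsub>M\<^esub> h'"
  shows "u = u'" and "h = h'"
proof -
  note UE = submoduleE[OF assms(1)] and HE = submoduleE[OF assms(2)]
  have carr: "u \<in> carrier M" "u' \<in> carrier M" "h \<in> carrier M" "h' \<in> carrier M"
    using assms UE(1) HE(1) by auto
  have "\<ominus>\<^bsub>M\<^esub> u' \<oplus>\<^bsub>M\<^esub> (u \<oplus>\<^bsub>M\<^esub> h) \<oplus>\<^bsub>M\<^esub> \<ominus>\<^bsub>M\<^esub> h = \<ominus>\<^bsub>M\<^esub> u' \<oplus>\<^bsub>M\<^esub> (u' \<oplus>\<^bsub>M\<^esub> h') \<oplus>\<^bsub>M\<^esub> \<ominus>\<^bsub>M\<^esub> h"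
    using eq by simp
  then have "\<ominus>\<^bsub>M\<^esub> u' \<oplus>\<^bsub>M\<^esub> u = h' \<oplus>\<^bsub>M\<^esub> \<ominus>\<^bsub>M\<^esub> h"
    using carr by (simp add: M.a_assoc M.r_neg M.r_neg1 M.r_neg2)
  moreover have "\<ominus>\<^bsub>M\<^esub> u' \<oplus>\<^bsub>M\<^esub> u \<in> U" using assms UE by blast
  moreover have "h' \<oplus>\<^bsub>M\<^esub> \<ominus>\<^bsub>M\<^esub> h \<in> H" using assms HE by blast
  ultimately have "\<ominus>\<^bsub>M\<^esub> u' \<oplus>\<^bsub>M\<^esub> u = \<zero>\<^bsub>M\<^esub>" using assms(3) by auto
  then show "u = u'" using carr by (metis M.add.inv_closed M.minus_equality M.minus_minus)
  then show "h = h'" using eq carr by simp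
qed

text \<open>The functional is the coordinate along \<open>a\<close> in a decomposition of
  \<open>M\<close> into the line through \<open>a\<close> and a complement \<open>H\<close>.\<close>

lemma (in module) linear_functional_exists:
  assumes "field R" and a: "a \<in> carrier M" "a \<noteq> \<zero>\<^bsub>M\<^esub>"
  obtains \<phi> where "\<phi> \<in> carrier M \<rightarrow> carrier R"
    and "\<And>x y. \<lbrakk>x \<in> carrier M; y \<in> carrier M\<rbrakk> \<Longrightarrow> \<phi> (x \<oplus>\<^bsub>M\<^esub> y) = \<phi> x \<oplus> \<phi> y"
    and "\<And>c x. \<lbrakk>c \<in> carrier R; x \<in> carrier M\<rbrakk> \<Longrightarrow> \<phi> (c \<odot>\<^bsub>M\<^esub> x) = c \<otimes> \<phi> x"
    and "\<phi> a = \<one>"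
proof -
  interpret field R by fact
  define U where "U = {c \<odot>\<^bsub>M\<^esub> a | c. c \<in> carrier R}"
  have "submodule {\<zero>\<^bsub>M\<^esub>} R M"
    by (rule submoduleI) auto
  then have "submodule {h \<oplus>\<^bsub>M\<^esub> c \<odot>\<^bsub>M\<^esub> a | h c. h \<in> {\<zero>\<^bsub>M\<^esub>} \<and> c \<in> carrier R} R M"
    using submodule_add_line a(1) by blast
  moreover have "{h \<oplus>\<^bsub>M\<^esub> c \<odot>\<^bsub>M\<^esub> a | h c. h \<in> {\<zero>\<^bsub>M\<^esub>} \<and> c \<in> carrier R} = U"
    unfolding U_def using a(1) by force
  ultimately have U: "submodule U R M" by simp
  obtain H where H: "submodule H R M" "U \<inter> H = {\<zero>\<^bsub>M\<^esub>}"
    and dec: "\<And>x. x \<in> carrier M \<Longrightarrow> \<exists>u\<in>U. \<exists>h\<in>H. x = u \<oplus>\<^bsub>M\<^esub> h"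
    using submodule_complement[OF assms(1) U] by blast
  note HE = submoduleE[OF H(1)]
  \<comment> \<open>If two scalars differed, their difference \<open>d\<close> would be invertible
    and annihilate \<open>a\<close>, forcing \<open>a\<close> to be zero.\<close>
  have inj: "c = c'" if "c \<in> carrier R" "c' \<in> carrier R" "c \<odot>\<^bsub>M\<^esub> a = c' \<odot>\<^bsub>M\<^esub> a" for c c'
  proof (rule ccontr)
    assume "c \<noteq> c'"
    define d where "d = c \<ominus> c'"
    have d: "d \<in> carrier R" "d \<noteq> \<zero>"
      using that \<open>c \<noteq> c'\<close> by (auto simp: d_def)
    have "d \<odot>\<^bsub>M\<^esub> a = \<zero>\<^bsub>M\<^esub>"
      using that a by (simp add: d_def a_minus_def smult_l_distr smult_l_minus M.r_neg)
    moreover have "inv d \<in> carrier R" "inv d \<otimes> d = \<one>"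
      using d field_Units by auto
    ultimately have "\<one> \<odot>\<^bsub>M\<^esub> a = \<zero>\<^bsub>M\<^esub>"
      using d a smult_assoc1[of "inv d" d a] by simp
    then show False using a by simp
  qed
  \<comment> \<open>\<open>P\<close> is the graph of the functional. Once it is single-valued, each
    law for \<open>\<phi>\<close> follows by exhibiting a decomposition of the vector in
    question.\<close>
  define P where "P x c \<longleftrightarrow> c \<in> carrier R \<and> (\<exists>h\<in>H. x = c \<odot>\<^bsub>M\<^esub> a \<oplus>\<^bsub>M\<^esub> h)" for x c
  have uniq: "c = c'" if p: "P x c" "P x c'" for x c c'
  proof -
    have c: "c \<in> carrier R" "c' \<in> carrier R" using that by (simp_all add: P_def)
    obtain h where h: "h \<in> H" "x = c \<odot>\<^bsub>M\<^esub> a \<oplus>\<^bsub>M\<^esub> h" using p(1) unfolding P_def by blast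
    obtain h' where h': "h' \<in> H" "x = c' \<odot>\<^bsub>M\<^esub> a \<oplus>\<^bsub>M\<^esub> h'" using p(2) unfolding P_def by blast
    have "c \<odot>\<^bsub>M\<^esub> a \<in> U" "c' \<odot>\<^bsub>M\<^esub> a \<in> U" using c unfolding U_def by auto
    then have "c \<odot>\<^bsub>M\<^esub> a = c' \<odot>\<^bsub>M\<^esub> a"
      using complement_unique(1)[OF U H _ _ h(1) h'(1)] h(2) h'(2) by simp
    then show ?thesis using inj c by simp
  qed
  define \<phi> where "\<phi> x = (THE c. P x c)" for x
  have phiI: "\<phi> x = c" if "P x c" for x c
    unfolding \<phi>_def using that uniq by blast
  have P: "P x (\<phi> x)" if x: "x \<in> carrier M" for x
  proof -
    obtain c where "P x c" using dec[OF x] unfolding P_def U_def by blast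
    then show ?thesis using phiI by simp
  qed
  show thesis
  proof
    show "\<phi> \<in> carrier M \<rightarrow> carrier R" using P by (auto simp: P_def)
    have "\<one> \<odot>\<^bsub>M\<^esub> a \<oplus>\<^bsub>M\<^esub> \<zero>\<^bsub>M\<^esub> = a" using a by simp
    moreover have "\<zero>\<^bsub>M\<^esub> \<in> H" using H(2) by blast
    ultimately have "P a \<one>" unfolding P_def by (metis R.one_closed)
    then show "\<phi> a = \<one>" by (rule phiI)
  next
    fix x y assume xy: "x \<in> carrier M" "y \<in> carrier M"
    have c: "\<phi> x \<in> carrier R" "\<phi> y \<in> carrier R" using P xy by (simp_all add: P_def)
    obtain h where h: "h \<in> H" "x = \<phi> x \<odot>\<^bsub>M\<^esub> a \<oplus>\<^bsub>M\<^esub> h" using P[OF xy(1)] unfolding P_def by blast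
    obtain h' where h': "h' \<in> H" "y = \<phi> y \<odot>\<^bsub>M\<^esub> a \<oplus>\<^bsub>M\<^esub> h'" using P[OF xy(2)] unfolding P_def by blast
    have hc: "h \<in> carrier M" "h' \<in> carrier M" using h(1) h'(1) HE(1) by auto
    have "x \<oplus>\<^bsub>M\<^esub> y = (\<phi> x \<odot>\<^bsub>M\<^esub> a \<oplus>\<^bsub>M\<^esub> h) \<oplus>\<^bsub>M\<^esub> (\<phi> y \<odot>\<^bsub>M\<^esub> a \<oplus>\<^bsub>M\<^esub> h')"
      using h(2) h'(2) by simp
    also have "\<dots> = (\<phi> x \<oplus> \<phi> y) \<odot>\<^bsub>M\<^esub> a \<oplus>\<^bsub>M\<^esub> (h \<oplus>\<^bsub>M\<^esub> h')"
      using c a hc by (simp add: smult_l_distr M.a_ac)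
    finally have "P (x \<oplus>\<^bsub>M\<^esub> y) (\<phi> x \<oplus> \<phi> y)"
      unfolding P_def using c HE(5)[OF h(1) h'(1)] by blast
    then show "\<phi> (x \<oplus>\<^bsub>M\<^esub> y) = \<phi> x \<oplus> \<phi> y" by (rule phiI)
  next
    fix c x assume c: "c \<in> carrier R" and x: "x \<in> carrier M"
    obtain h where hs: "h \<in> H" "x = \<phi> x \<odot>\<^bsub>M\<^esub> a \<oplus>\<^bsub>M\<^esub> h" and px: "\<phi> x \<in> carrier R"
      using P[OF x] unfolding P_def by blast
    have hc: "h \<in> carrier M" using hs HE(1) by auto
    have "c \<odot>\<^bsub>M\<^esub> x = c \<odot>\<^bsub>M\<^esub> (\<phi> x \<odot>\<^bsub>M\<^esub> a \<oplus>\<^bsub>M\<^esub> h)" using hs(2) by simp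
    also have "\<dots> = (c \<otimes> \<phi> x) \<odot>\<^bsub>M\<^esub> a \<oplus>\<^bsub>M\<^esub> c \<odot>\<^bsub>M\<^esub> h"
      using c px a hc by (simp add: smult_r_distr smult_assoc1)
    finally have "P (c \<odot>\<^bsub>M\<^esub> x) (c \<otimes> \<phi> x)"
      unfolding P_def using c px HE(4)[OF c hs(1)] by blast
    then show "\<phi> (c \<odot>\<^bsub>M\<^esub> x) = c \<otimes> \<phi> x" by (rule phiI)
  qed
qed

section \<open>Linear endomorphisms and their right inverses\<close>

text \<open>Fixing the values outside the carrier makes operators that agree on the carrier equal in
  HOL, so that the ring axioms can hold as plain equations.\<close>

definition linear_endos :: "('k, 'm) ring_scheme \<Rightarrow> ('k, 'v, 'n) module_scheme \<Rightarrow> ('v \<Rightarrow> 'v) set" where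
  "linear_endos K V = {T \<in> carrier V \<rightarrow>\<^sub>E carrier V.
     (\<forall>x\<in>carrier V. \<forall>y\<in>carrier V. T (x \<oplus>\<^bsub>V\<^esub> y) = T x \<oplus>\<^bsub>V\<^esub> T y) \<and>
     (\<forall>c\<in>carrier K. \<forall>x\<in>carrier V. T (c \<odot>\<^bsub>V\<^esub> x) = c \<odot>\<^bsub>V\<^esub> T x)}"

lemma linear_endosI:
  assumes "\<And>x. x \<in> carrier V \<Longrightarrow> T x \<in> carrier V"
    and "\<And>x y. \<lbrakk>x \<in> carrier V; y \<in> carrier V\<rbrakk> \<Longrightarrow> T (x \<oplus>\<^bsub>V\<^esub> y) = T x \<oplus>\<^bsub>V\<^esub> T y"
    and "\<And>c x. \<lbrakk>c \<in> carrier K; x \<in> carrier V\<rbrakk> \<Longrightarrow> T (c \<odot>\<^bsub>V\<^esub> x) = c \<odot>\<^bsub>V\<^esub> T x"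
    and "T \<in> extensional (carrier V)"
  shows "T \<in> linear_endos K V"
  using assms by (simp add: linear_endos_def PiE_iff)

lemma linear_endosD:
  assumes "T \<in> linear_endos K V"
  shows "x \<in> carrier V \<Longrightarrow> T x \<in> carrier V"
    and "\<lbrakk>x \<in> carrier V; y \<in> carrier V\<rbrakk> \<Longrightarrow> T (x \<oplus>\<^bsub>V\<^esub> y) = T x \<oplus>\<^bsub>V\<^esub> T y"
    and "\<lbrakk>c \<in> carrier K; x \<in> carrier V\<rbrakk> \<Longrightarrow> T (c \<odot>\<^bsub>V\<^esub> x) = c \<odot>\<^bsub>V\<^esub> T x"
    and "T \<in> extensional (carrier V)"
  using assms by (auto simp add: linear_endos_def PiE_iff)

lemma (in module) linear_endo_zero:
  assumes "T \<in> linear_endos R M"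
  shows "T \<zero>\<^bsub>M\<^esub> = \<zero>\<^bsub>M\<^esub>"
  using linear_endosD(3)[OF assms, of \<zero> "\<zero>\<^bsub>M\<^esub>"] linear_endosD(1)[OF assms, of "\<zero>\<^bsub>M\<^esub>"] by simp

lemma (in module) linear_endo_minus:
  assumes "T \<in> linear_endos R M" "x \<in> carrier M"
  shows "T (\<ominus>\<^bsub>M\<^esub> x) = \<ominus>\<^bsub>M\<^esub> T x"
  using linear_endosD(3)[OF assms(1), of "\<ominus> \<one>" x] linear_endosD(1)[OF assms] assms(2)
  by (simp add: smult_l_minus)

text \<open>On a complement \<open>H\<close> of its kernel \<open>U\<close>, the map
  \<open>N\<close> is injective and still reaches everything; \<open>Y\<close> is the inverse of
  this restriction.\<close>

lemma (in module) linear_section_exists: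
  assumes "field R" and N: "N \<in> linear_endos R M" and surj: "carrier M \<subseteq> N ` carrier M"
  obtains Y where "Y \<in> linear_endos R M" and "\<And>x. x \<in> carrier M \<Longrightarrow> N (Y x) = x"
proof -
  note ND = linear_endosD[OF N]
  define U where "U = {x \<in> carrier M. N x = \<zero>\<^bsub>M\<^esub>}"
  have U: "submodule U R M"
    by (rule submoduleI) (auto simp: U_def ND linear_endo_zero[OF N] linear_endo_minus[OF N])
  obtain H where H: "submodule H R M" "U \<inter> H = {\<zero>\<^bsub>M\<^esub>}"
    and dec: "\<And>x. x \<in> carrier M \<Longrightarrow> \<exists>u\<in>U. \<exists>h\<in>H. x = u \<oplus>\<^bsub>M\<^esub> h"
    using submodule_complement[OF assms(1) U] by blast
  note HE = submoduleE[OF H(1)]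
  have Hc: "h \<in> carrier M" if "h \<in> H" for h using HE(1) that by blast
  have uniq: "h = h'" if h: "h \<in> H" "h' \<in> H" "N h = N h'" for h h'
  proof -
    have "N (h \<oplus>\<^bsub>M\<^esub> \<ominus>\<^bsub>M\<^esub> h') = \<zero>\<^bsub>M\<^esub>"
      using h Hc by (simp add: ND linear_endo_minus[OF N] M.r_neg)
    then have "h \<oplus>\<^bsub>M\<^esub> \<ominus>\<^bsub>M\<^esub> h' \<in> U \<inter> H"
      using h Hc HE unfolding U_def by simp
    then have "h \<oplus>\<^bsub>M\<^esub> \<ominus>\<^bsub>M\<^esub> h' = \<zero>\<^bsub>M\<^esub>" using H(2) by blast
    then show "h = h'" using h Hc by (metis M.add.inv_closed M.minus_equality M.minus_minus M.a_comm)
  qed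
  have ex: "\<exists>h\<in>H. N h = x" if x: "x \<in> carrier M" for x
  proof -
    obtain y where y: "y \<in> carrier M" "N y = x" using surj x by blast
    obtain u h where "u \<in> U" "h \<in> H" "y = u \<oplus>\<^bsub>M\<^esub> h" using dec[OF y(1)] by blast
    then have "N h = x" using y Hc ND unfolding U_def by simp
    then show ?thesis using \<open>h \<in> H\<close> by blast
  qed
  define Y where "Y = (\<lambda>x\<in>carrier M. THE h. h \<in> H \<and> N h = x)"
  have YI: "Y x = h" if "h \<in> H" "N h = x" for x h
    using that ND(1) Hc uniq by (auto simp: Y_def intro!: the_equality)
  have Y: "Y x \<in> H" "N (Y x) = x" if "x \<in> carrier M" for x
    using ex[OF that] YI by auto
  \<comment> \<open>Sums and multiples of preimages in \<open>H\<close> are again preimages in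
    \<open>H\<close>; uniqueness, through \<open>YI\<close>, turns this into linearity.\<close>
  have "Y \<in> linear_endos R M"
    by (rule linear_endosI)
      (auto simp: Y Hc ND HE intro!: YI, simp add: Y_def)
  then show thesis using that Y(2) by blast
qed

section \<open>Encodings by words\<close>

text \<open>A prefix code on two distinguished letters. It makes lists of words into words even over
  a finite alphabet, which is what keeps all later constructions within one type of words.\<close>

lemma inj_list_list_encoding:
  assumes "p \<noteq> (q :: 'a)"
  obtains enc :: "'a list list \<Rightarrow> 'a list" where "inj enc"
proof -
  \<comment> \<open>Every other letter is a marker: \<open>p\<close> announces one more letter of
    the word, \<open>q\<close> its end. A \<open>p\<close> or \<open>q\<close> occurring in
    \<open>xs\<close> itself stands at a payload position and causes no confusion.\<close>
  define code where "code xs = concat (map (\<lambda>x. [p, x]) xs) @ [q]" for xs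
  have prefix_free: "xs = ys \<and> r = s" if "code xs @ r = code ys @ s" for xs ys r s
    using that
  proof (induction xs arbitrary: ys)
    case Nil
    then show ?case using assms by (cases ys) (auto simp: code_def)
  next
    case (Cons x xs)
    then show ?case using assms by (cases ys) (auto simp: code_def)
  qed
  have "inj (\<lambda>xss. concat (map code xss))"
  proof (rule injI)
    fix xss yss assume "concat (map code xss) = concat (map code yss)"
    then show "xss = yss"
    proof (induction xss arbitrary: yss)
      case Nil
      then show ?case by (cases yss) (auto simp: code_def)
    next
      case (Cons xs xss)
      then obtain ys yss' where yss: "yss = ys # yss'"
        by (cases yss) (auto simp: code_def)
      then have "code xs @ concat (map code xss) = code ys @ concat (map code yss')"
        using Cons.prems by simp
      then have "xs = ys" "concat (map code xss) = concat (map code yss')"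
        using prefix_free by blast+
      then show ?case using Cons.IH yss by simp
    qed
  qed
  then show thesis by (rule that)
qed

text \<open>A finitely supported function is determined by the finite part of its graph off the
  default value \<open>z\<close>, and a finite set of words can be listed and encoded as a single
  word.\<close>

lemma inj_finite_support_encoding:
  assumes "p \<noteq> (q :: 'a)"
  obtains c :: "('a list \<Rightarrow> 'a) \<Rightarrow> 'a list" where "inj_on c {w. finite {i. w i \<noteq> z}}"
proof -
  obtain enc :: "'a list list \<Rightarrow> 'a list" where enc: "inj enc"
    using inj_list_list_encoding[OF assms] .
  \<comment> \<open>Values are letters and indices are words, so prepending the value to the index
    packs the pair into one word.\<close>
  define graph where "graph w = {w i # i | i. w i \<noteq> z}" for w :: "'a list \<Rightarrow> 'a"
  \<comment> \<open>The order of the enumeration is immaterial, as only its set of entries is used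
    for decoding.\<close>
  define elems where "elems w = (SOME xss. set xss = graph w)" for w
  have elems: "set (elems w) = graph w" if "finite {i. w i \<noteq> z}" for w
  proof -
    have "graph w = (\<lambda>i. w i # i) ` {i. w i \<noteq> z}" by (auto simp: graph_def)
    then have "finite (graph w)" using that by simp
    then have "\<exists>xss. set xss = graph w" by (rule finite_list)
    then show ?thesis unfolding elems_def by (rule someI_ex)
  qed
  have "inj_on (\<lambda>w. enc (elems w)) {w. finite {i. w i \<noteq> z}}"
  proof (rule inj_onI)
    fix v w assume "v \<in> {w. finite {i. w i \<noteq> z}}" "w \<in> {w. finite {i. w i \<noteq> z}}"
      and "enc (elems v) = enc (elems w)"
    then have "graph v = graph w"
      using elems[of v] elems[of w] injD[OF enc] by (metis mem_Collect_eq)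
    then have "x # i \<in> graph v \<longleftrightarrow> x # i \<in> graph w" for x i
      by simp
    then have eq: "x = v i \<and> x \<noteq> z \<longleftrightarrow> x = w i \<and> x \<noteq> z" for x i
      by (auto simp: graph_def)
    have "v i = w i" for i
      using eq[of "v i" i] eq[of "w i" i] by (cases "v i = z") auto
    then show "v = w" by (rule ext)
  qed
  then show thesis by (rule that)
qed

section \<open>Quotients of differential algebras\<close>

text \<open>Zorn's lemma applied to the ideals that omit \<open>\<one>\<close>: these are the proper
  ideals, and omitting one element passes to unions of chains.\<close>

lemma (in ring) maximalideal_exists:
  assumes "\<one> \<noteq> \<zero>"
  obtains M where "maximalideal M R"
proof -
  define F where "F = {I. ideal I R \<and> \<one> \<notin> I}"
  have ne: "F \<noteq> {}"
    using zeroideal assms by (auto simp: F_def)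
  have "\<exists>M\<in>F. \<forall>J\<in>F. M \<subseteq> J \<longrightarrow> J = M"
  proof (rule subset_Zorn_nonempty[OF ne])
    fix C assume C: "C \<noteq> {}" "subset.chain F C"
    then have "subset.chain {I. ideal I R} C"
      unfolding pred_on.chain_def F_def by auto
    from chain_Union_is_ideal[OF this] have "ideal (\<Union>C) R"
      using C(1) by simp
    moreover have "\<one> \<notin> \<Union>C"
      using C(2) unfolding pred_on.chain_def F_def by blast
    ultimately show "\<Union>C \<in> F" by (simp add: F_def)
  qed
  then obtain M where M: "M \<in> F" and max: "\<forall>J\<in>F. M \<subseteq> J \<longrightarrow> J = M" by (rule bexE)
  have "maximalideal M R"
  proof (rule maximalidealI)
    show "ideal M R" "carrier R \<noteq> M" using M by (auto simp: F_def)
    fix J assume "ideal J R" "M \<subseteq> J" "J \<subseteq> carrier R"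
    then show "J = M \<or> J = carrier R"
      using max ideal.one_imp_carrier[of J R] by (auto simp: F_def)
  qed
  then show thesis by (rule that)
qed

text \<open>Realizes the quotient by \<open>I\<close> in a prescribed type \<open>'y\<close>, where
  cosets would live in the type of sets over \<open>'a\<close>. A weak morphism only has to have the
  cosets of \<open>I\<close> as fibres; the operations on its image are transported
  afterwards.\<close>

lemma (in ring) weak_ring_morphism_exists:
  fixes \<iota> :: "'a \<Rightarrow> 'y"
  assumes "ideal I R" and "inj_on \<iota> (carrier R)"
  obtains f :: "'a \<Rightarrow> 'y" where "weak_ring_morphism f I R"
proof -
  interpret I: ideal I R by fact
  \<comment> \<open>The choice depends on the coset alone, so \<open>rep\<close> is constant on
    cosets; it separates them because it picks a member of each.\<close>
  define rep where "rep x = (SOME y. y \<in> I +> x)" for x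
  have rep: "rep x \<in> I +> x" if "x \<in> carrier R" for x
    unfolding rep_def using I.a_rcos_self[OF that] by (rule someI)
  have carr: "rep x \<in> carrier R" if "x \<in> carrier R" for x
    using rep[OF that] a_r_coset_subset_G[OF I.a_subset that] by blast
  have "\<iota> (rep x) = \<iota> (rep y) \<longleftrightarrow> x \<ominus> y \<in> I" if xy: "x \<in> carrier R" "y \<in> carrier R" for x y
  proof -
    have "rep x = rep y \<longleftrightarrow> I +> x = I +> y"
    proof
      assume "rep x = rep y"
      then show "I +> x = I +> y"
        using rep[OF xy(1)] rep[OF xy(2)] xy a_repr_independence[OF _ _ I.a_subgroup] by metis
    next
      assume "I +> x = I +> y"
      then show "rep x = rep y" by (simp add: rep_def)
    qed
    then show ?thesis
      using quotient_eq_iff_same_a_r_cos[OF assms(1) xy] inj_on_eq_iff[OF assms(2)] carr xy by simp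
  qed
  then have "weak_ring_morphism (\<lambda>x. \<iota> (rep x)) I R"
    by (intro weak_ring_morphismI assms(1))
  then show thesis by (rule that)
qed

text \<open>As in \<open>image_ring\<close>, the preimages chosen by \<open>inv_into\<close> are irrelevant as soon as the fibres of
  \<open>f\<close> are the cosets of an ideal closed under the operations.\<close>

definition image_diff_algebra ::
  "('r \<Rightarrow> 's) \<Rightarrow> ('k, 'r, 'd) diff_algebra \<Rightarrow> ('k, 's, 'd) diff_algebra" where
  "image_diff_algebra f R =
    \<lparr>carrier = carrier (image_ring f R), monoid.mult = monoid.mult (image_ring f R),
     one = monoid.one (image_ring f R), ring.zero = ring.zero (image_ring f R),
     ring.add = ring.add (image_ring f R),
     smult = (\<lambda>c x. f (c \<odot>\<^bsub>R\<^esub> inv_into (carrier R) f x)),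
     dop = (\<lambda>D x. f (dop R D (inv_into (carrier R) f x)))\<rparr>"

lemma (in D_algebra) dop_zero:
  assumes "D \<in> Ds"
  shows "dop A D \<zero>\<^bsub>A\<^esub> = \<zero>\<^bsub>A\<^esub>"
proof -
  have "dop A D (\<zero> \<odot>\<^bsub>A\<^esub> \<zero>\<^bsub>A\<^esub>) = \<zero> \<odot>\<^bsub>A\<^esub> dop A D \<zero>\<^bsub>A\<^esub>"
    using assms by (intro dop_smult) auto
  then show ?thesis using assms dop_closed[of D "\<zero>\<^bsub>A\<^esub>"] by simp
qed

text \<open>Each axiom is pulled back along \<open>f\<close>. The condition on zero is stated
  separately, since preservation of zero by a homomorphism could only be derived once
  \<open>S\<close> is known to be a ring.\<close>

lemma ring_surjective_image:
  fixes R :: "('r, 'm) ring_scheme" and S :: "('s, 'n) ring_scheme"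
  assumes "ring R"
    and hom: "f \<in> ring_hom R S" and surj: "carrier S = f ` carrier R" and z: "\<zero>\<^bsub>S\<^esub> = f \<zero>\<^bsub>R\<^esub>"
  shows "ring S"
proof -
  interpret ring R by fact
  note h = ring_hom_closed[OF hom] ring_hom_mult[OF hom, symmetric]
    ring_hom_add[OF hom, symmetric] ring_hom_one[OF hom, symmetric] z
  show ?thesis
  proof (rule ringI)
    show "abelian_group S"
    proof (rule abelian_groupI)
      fix x assume "x \<in> carrier S"
      then obtain r where "r \<in> carrier R" "x = f r" using surj by blast
      then show "\<exists>y\<in>carrier S. y \<oplus>\<^bsub>S\<^esub> x = \<zero>\<^bsub>S\<^esub>"
        using h(1) by (intro bexI[of _ "f (\<ominus>\<^bsub>R\<^esub> r)"]) (simp_all add: h l_neg)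
    qed (use surj in \<open>auto simp: h a_ac\<close>)
    show "monoid S"
      by (rule monoidI) (use surj in \<open>auto simp: h m_assoc\<close>)
  qed (use surj in \<open>auto simp: h l_distr r_distr\<close>)
qed

text \<open>The point is independence of the preimage chosen by \<open>inv_into\<close>: two
  preimages differ by an element of \<open>I\<close>, and \<open>I\<close> is closed under scalars
  and under the operations.\<close>

lemma D_algebra_image:
  fixes R :: "('k, 'r, 'd) diff_algebra"
  assumes "D_algebra K Ds R" and w: "weak_ring_morphism f I R"
    and Dcl: "\<And>D x. \<lbrakk>D \<in> Ds; x \<in> I\<rbrakk> \<Longrightarrow> dop R D x \<in> I"
  shows "D_algebra K Ds (image_diff_algebra f R)"
    and "f \<in> D_hom K Ds R (image_diff_algebra f R)"
proof -
  interpret R: D_algebra K Ds R by fact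
  interpret I: ideal I R using w by (rule weak_ring_morphism.axioms)
  let ?S = "image_diff_algebra f R"
  have eqI: "f x = f y \<longleftrightarrow> x \<ominus>\<^bsub>R\<^esub> y \<in> I" if "x \<in> carrier R" "y \<in> carrier R" for x y
    using weak_ring_morphism.inj_mod_ideal[OF w that] .
  have carr: "carrier ?S = f ` carrier R"
    by (simp add: image_diff_algebra_def image_ring_carrier)
  have "f \<in> ring_hom R (image_ring f R)"
    using R.weak_ring_morphism_is_hom[OF w] .
  then have hom: "f \<in> ring_hom R ?S"
    by (simp add: ring_hom_def image_diff_algebra_def)
  have zero: "\<zero>\<^bsub>?S\<^esub> = f \<zero>\<^bsub>R\<^esub>"
    by (simp add: image_diff_algebra_def image_ring_zero)
  have ring: "ring ?S"
    using ring_surjective_image[OF R.A.ring_axioms hom carr zero] .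
  have inv: "inv_into (carrier R) f (f x) \<in> carrier R" "x \<ominus>\<^bsub>R\<^esub> inv_into (carrier R) f (f x) \<in> I"
    if "x \<in> carrier R" for x
    using that eqI[of x "inv_into (carrier R) f (f x)"]
    by (simp_all add: inv_into_into f_inv_into_f)
  have sm: "c \<odot>\<^bsub>?S\<^esub> f x = f (c \<odot>\<^bsub>R\<^esub> x)" if c: "c \<in> carrier K" and x: "x \<in> carrier R" for c x
  proof -
    let ?x = "inv_into (carrier R) f (f x)"
    \<comment> \<open>\<open>I\<close> is given only as a ring ideal; it absorbs the scalar
      \<open>c\<close> because \<open>c\<close> acts as multiplication by \<open>c\<close> times the
      unit.\<close>
    have "c \<odot>\<^bsub>R\<^esub> x \<ominus>\<^bsub>R\<^esub> c \<odot>\<^bsub>R\<^esub> ?x = c \<odot>\<^bsub>R\<^esub> (x \<ominus>\<^bsub>R\<^esub> ?x)"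
      using c x inv by (simp add: a_minus_def R.smult_r_distr R.smult_r_minus)
    also have "\<dots> = (c \<odot>\<^bsub>R\<^esub> \<one>\<^bsub>R\<^esub>) \<otimes>\<^bsub>R\<^esub> (x \<ominus>\<^bsub>R\<^esub> ?x)"
      using c x inv by (simp add: R.smult_mult_left)
    also have "\<dots> \<in> I" using c x inv I.I_l_closed by simp
    finally have "f (c \<odot>\<^bsub>R\<^esub> x) = f (c \<odot>\<^bsub>R\<^esub> ?x)" using c x inv eqI by simp
    then show ?thesis by (simp add: image_diff_algebra_def)
  qed
  have dp: "dop ?S D (f x) = f (dop R D x)" if D: "D \<in> Ds" and x: "x \<in> carrier R" for D x
  proof -
    let ?x = "inv_into (carrier R) f (f x)"
    have mx: "dop R D (\<ominus>\<^bsub>R\<^esub> y) = \<ominus>\<^bsub>R\<^esub> dop R D y" if "y \<in> carrier R" for y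
      using R.dop_add[OF D that, of "\<ominus>\<^bsub>R\<^esub> y"] R.dop_closed[OF D] R.dop_zero[OF D] that
      by (simp add: R.M.r_neg) (metis R.M.a_inv_closed R.M.minus_equality R.M.a_comm)
    have "dop R D x \<ominus>\<^bsub>R\<^esub> dop R D ?x = dop R D (x \<ominus>\<^bsub>R\<^esub> ?x)"
      using D x inv by (simp add: a_minus_def R.dop_add mx)
    also have "\<dots> \<in> I" using D x inv Dcl by simp
    finally have "f (dop R D x) = f (dop R D ?x)" using D x inv R.dop_closed eqI by simp
    then show ?thesis by (simp add: image_diff_algebra_def)
  qed
  have h: "f x \<otimes>\<^bsub>?S\<^esub> f y = f (x \<otimes>\<^bsub>R\<^esub> y)" "f x \<oplus>\<^bsub>?S\<^esub> f y = f (x \<oplus>\<^bsub>R\<^esub> y)"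
    if "x \<in> carrier R" "y \<in> carrier R" for x y
    using ring_hom_mult[OF hom that] ring_hom_add[OF hom that] by simp_all
  interpret S: ring ?S by (rule ring)
  have "module K ?S"
    by (rule moduleI)
      (auto simp: carr sm h R.R.is_cring S.abelian_group_axioms R.smult_l_distr
        R.smult_r_distr R.smult_assoc1)
  then show "D_algebra K Ds ?S"
    by (intro D_algebra.intro assoc_algebra.intro R.field_axioms ring assoc_algebra_axioms.intro
        D_algebra_axioms.intro)
      (auto simp: carr sm h dp R.dop_closed R.dop_add R.dop_smult R.dop_mult
        R.smult_mult_left R.smult_mult_right)
  show "f \<in> D_hom K Ds R ?S"
    using hom sm dp by (simp add: D_hom_def)
qed

text \<open>An ideal \<open>J\<close> of the image pulls back to an ideal \<open>J'\<close>
  containing \<open>I\<close>, the fibre of zero. Maximality leaves two choices for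
  \<open>J'\<close>, and \<open>J\<close> is recovered as the image of \<open>J'\<close>.\<close>

lemma simple_image_maximalideal:
  fixes R :: "('k, 'r, 'd) diff_algebra"
  assumes "D_algebra K Ds R" and w: "weak_ring_morphism f I R" and max: "maximalideal I R"
    and Dcl: "\<And>D x. \<lbrakk>D \<in> Ds; x \<in> I\<rbrakk> \<Longrightarrow> dop R D x \<in> I"
  shows "simple_D_algebra K Ds (image_diff_algebra f R)"
proof -
  interpret R: D_algebra K Ds R by fact
  interpret I: maximalideal I R by fact
  let ?S = "image_diff_algebra f R"
  interpret S: D_algebra K Ds ?S
    using D_algebra_image(1)[OF assms(1) w Dcl] .
  have hom: "f \<in> ring_hom R ?S"
    using D_algebra_image(2)[OF assms(1) w Dcl] by (simp add: D_hom_def)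
  interpret f: ring_hom_ring R ?S f
    by (rule ring_hom_ringI2[OF R.A.ring_axioms S.A.ring_axioms hom])
  have carr: "carrier ?S = f ` carrier R"
    by (simp add: image_diff_algebra_def image_ring_carrier)
  have ker: "f x = \<zero>\<^bsub>?S\<^esub> \<longleftrightarrow> x \<in> I" if "x \<in> carrier R" for x
    using weak_ring_morphism.inj_mod_ideal[OF w that R.M.zero_closed] that
    by (simp add: a_minus_def)
  show ?thesis
  proof (unfold_locales)
    obtain x where "x \<in> carrier R" "x \<notin> I" using I.I_notcarr I.a_subset by blast
    then show "carrier ?S \<noteq> {\<zero>\<^bsub>?S\<^esub>}" using ker carr by blast
  next
    fix J assume J: "ideal J ?S"
    interpret J: ideal J ?S by fact
    define J' where "J' = {x \<in> carrier R. f x \<in> J}"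
    have "ideal J' R"
    proof (rule idealI[OF R.A.ring_axioms])
      show "subgroup J' (add_monoid R)"
        by (rule R.M.add.subgroupI) (auto simp: J'_def a_inv_def[symmetric] intro!: exI[of _ "\<zero>\<^bsub>R\<^esub>"])
    qed (auto simp: J'_def J.I_l_closed J.I_r_closed)
    moreover have "I \<subseteq> J'"
    proof
      fix x assume "x \<in> I"
      then have "x \<in> carrier R" "f x = \<zero>\<^bsub>?S\<^esub>" using ker I.Icarr by auto
      then show "x \<in> J'" by (simp add: J'_def)
    qed
    ultimately have "J' = I \<or> J' = carrier R"
      using I.I_maximal by (auto simp: J'_def)
    moreover have "J = f ` J'" using J.a_subset carr by (auto simp: J'_def)
    moreover have "f ` I = {\<zero>\<^bsub>?S\<^esub>}"
      using ker I.Icarr I.zero_closed by (metis f.hom_zero image_cong image_constant)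
    ultimately show "J = {\<zero>\<^bsub>?S\<^esub>} \<or> J = carrier ?S" using carr by auto
  qed
qed

section \<open>Endomorphisms of finitely supported functions\<close>

text \<open>The operation attached to \<open>D\<close> is the commutator with
  \<open>\<delta> D\<close>. All operators are cut down to the carrier to match
  \<open>linear_endos\<close>.\<close>

definition end_algebra ::
  "('k, 'm) ring_scheme \<Rightarrow> ('k, 'v, 'n) module_scheme \<Rightarrow> ('d \<Rightarrow> 'v \<Rightarrow> 'v) \<Rightarrow>
    ('k, 'v \<Rightarrow> 'v, 'd) diff_algebra" where
  "end_algebra K V \<delta> =
    \<lparr>carrier = linear_endos K V, monoid.mult = compose (carrier V), one = (\<lambda>x\<in>carrier V. x),
     ring.zero = (\<lambda>x\<in>carrier V. \<zero>\<^bsub>V\<^esub>), ring.add = (\<lambda>S T. \<lambda>x\<in>carrier V. S x \<oplus>\<^bsub>V\<^esub> T x),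
     smult = (\<lambda>c T. \<lambda>x\<in>carrier V. c \<odot>\<^bsub>V\<^esub> T x),
     dop = (\<lambda>D T. \<lambda>x\<in>carrier V. \<delta> D (T x) \<ominus>\<^bsub>V\<^esub> T (\<delta> D x))\<rparr>"

lemma (in module) end_algebra_D_algebra:
  fixes \<delta> :: "'e \<Rightarrow> 'c \<Rightarrow> 'c"
  assumes "field R" and \<delta>: "\<And>D. D \<in> Ds \<Longrightarrow> \<delta> D \<in> linear_endos R M"
  shows "D_algebra R Ds (end_algebra R M \<delta>)"
proof -
  interpret field R by fact
  let ?E = "end_algebra R M \<delta>"
  note lin = linear_endosD(1-3)
  \<comment> \<open>The scheme for every axiom below: \<open>ext\<close> reduces an identity of
    operators to its values, \<open>ev\<close> computes these in \<open>M\<close>, and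
    \<open>cl\<close> provides closure.\<close>
  have ext: "S = T" if "S \<in> linear_endos R M" "T \<in> linear_endos R M"
      "\<And>x. x \<in> carrier M \<Longrightarrow> S x = T x" for S T
    using linear_endosD(4)[OF that(1)] linear_endosD(4)[OF that(2)] that(3) by (rule extensionalityI)
  have carr: "carrier ?E = linear_endos R M" by (simp add: end_algebra_def)
  have add: "S \<oplus>\<^bsub>?E\<^esub> T \<in> linear_endos R M"
    if "S \<in> linear_endos R M" "T \<in> linear_endos R M" for S T
    by (rule linear_endosI) (simp_all add: end_algebra_def lin[OF that(1)] lin[OF that(2)]
        M.a_ac smult_r_distr)
  have mult: "S \<otimes>\<^bsub>?E\<^esub> T \<in> linear_endos R M"
    if "S \<in> linear_endos R M" "T \<in> linear_endos R M" for S T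
    by (rule linear_endosI) (simp_all add: end_algebra_def compose_def lin[OF that(1)] lin[OF that(2)])
  have smult: "c \<odot>\<^bsub>?E\<^esub> T \<in> linear_endos R M"
    if "c \<in> carrier R" "T \<in> linear_endos R M" for c T
    by (rule linear_endosI) (simp_all add: end_algebra_def lin[OF that(2)] that(1)
        smult_r_distr smult_assoc1[symmetric] R.m_comm)
  have one: "\<one>\<^bsub>?E\<^esub> \<in> linear_endos R M"
    by (rule linear_endosI) (simp_all add: end_algebra_def)
  have zero: "\<zero>\<^bsub>?E\<^esub> \<in> linear_endos R M"
    by (rule linear_endosI) (simp_all add: end_algebra_def)
  have dop: "dop ?E D T \<in> linear_endos R M" if "D \<in> Ds" "T \<in> linear_endos R M" for D T
    by (rule linear_endosI) (simp_all add: end_algebra_def lin[OF that(2)] lin[OF \<delta>[OF that(1)]]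
        a_minus_def M.minus_add M.a_ac smult_r_distr smult_r_minus)
  have ev: "(S \<oplus>\<^bsub>?E\<^esub> T) x = S x \<oplus>\<^bsub>M\<^esub> T x" "(S \<otimes>\<^bsub>?E\<^esub> T) x = S (T x)"
    "(c \<odot>\<^bsub>?E\<^esub> T) x = c \<odot>\<^bsub>M\<^esub> T x" "\<one>\<^bsub>?E\<^esub> x = x" "\<zero>\<^bsub>?E\<^esub> x = \<zero>\<^bsub>M\<^esub>"
    "dop ?E D T x = \<delta> D (T x) \<oplus>\<^bsub>M\<^esub> \<ominus>\<^bsub>M\<^esub> T (\<delta> D x)"
    if "x \<in> carrier M" for S T c x D
    using that by (simp_all add: end_algebra_def compose_def a_minus_def)
  note cl = add mult smult one zero dop
  have ab: "abelian_group ?E"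
  proof (rule abelian_groupI; unfold carr)
    fix T assume T: "T \<in> linear_endos R M"
    have "(\<ominus> \<one>) \<odot>\<^bsub>?E\<^esub> T \<oplus>\<^bsub>?E\<^esub> T = \<zero>\<^bsub>?E\<^esub>"
      by (rule ext) (simp_all add: cl T ev lin[OF T] smult_l_minus M.l_neg)
    then show "\<exists>S\<in>linear_endos R M. S \<oplus>\<^bsub>?E\<^esub> T = \<zero>\<^bsub>?E\<^esub>"
      using smult T by blast
  qed (auto intro!: ext simp: cl ev lin M.a_ac)
  have mon: "monoid ?E"
    by (rule monoidI; unfold carr) (auto intro!: ext simp: cl ev lin)
  have ring: "ring ?E"
    by (rule ringI[OF ab mon]; unfold carr) (auto intro!: ext simp: cl ev lin)
  have mod: "module R ?E"
    by (rule moduleI[OF R.is_cring ab]; unfold carr)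
      (auto intro!: ext simp: cl ev lin smult_l_distr smult_r_distr smult_assoc1)
  note \<delta>l = lin[OF \<delta>]
  show ?thesis
  proof (intro D_algebra.intro assoc_algebra.intro mod field_axioms ring
      assoc_algebra_axioms.intro D_algebra_axioms.intro; unfold carr)
    fix D S T assume D: "D \<in> Ds" and S: "S \<in> linear_endos R M" and T: "T \<in> linear_endos R M"
    note l = lin[OF S] lin[OF T] \<delta>l[OF D]
    show "dop ?E D (S \<oplus>\<^bsub>?E\<^esub> T) = dop ?E D S \<oplus>\<^bsub>?E\<^esub> dop ?E D T"
      by (rule ext) (simp_all add: cl D S T ev l M.minus_add M.a_ac)
    show "dop ?E D (S \<otimes>\<^bsub>?E\<^esub> T) = dop ?E D S \<otimes>\<^bsub>?E\<^esub> T \<oplus>\<^bsub>?E\<^esub> S \<otimes>\<^bsub>?E\<^esub> dop ?E D T"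
    proof (rule ext)
      fix x assume x: "x \<in> carrier M"
      \<comment> \<open>In the Leibniz rule for commutators the two mixed terms
        \<open>S (\<delta> D (T x))\<close> cancel.\<close>
      have "\<ominus>\<^bsub>M\<^esub> S (\<delta> D (T x)) \<oplus>\<^bsub>M\<^esub> (S (\<delta> D (T x)) \<oplus>\<^bsub>M\<^esub> \<ominus>\<^bsub>M\<^esub> S (T (\<delta> D x))) = \<ominus>\<^bsub>M\<^esub> S (T (\<delta> D x))"
        using x by (simp add: l M.r_neg1)
      then show "dop ?E D (S \<otimes>\<^bsub>?E\<^esub> T) x = (dop ?E D S \<otimes>\<^bsub>?E\<^esub> T \<oplus>\<^bsub>?E\<^esub> S \<otimes>\<^bsub>?E\<^esub> dop ?E D T) x"
        using x by (simp add: cl D S T ev l linear_endo_minus M.a_assoc)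
    qed (simp_all add: cl D S T)
  next
    fix D c T assume D: "D \<in> Ds" and c: "c \<in> carrier R" and T: "T \<in> linear_endos R M"
    note l = lin[OF T] \<delta>l[OF D]
    show "dop ?E D (c \<odot>\<^bsub>?E\<^esub> T) = c \<odot>\<^bsub>?E\<^esub> dop ?E D T"
      by (rule ext) (simp_all add: cl D c T ev l smult_r_distr smult_r_minus)
  qed (auto intro!: ext simp: cl ev lin)
qed

section \<open>Direct sums of copies of a module\<close>

text \<open>The direct sum of copies of \<open>M\<close> indexed by the whole type
  \<open>'i\<close>. The module record inherits the fields for multiplication and unit from rings;
  they carry no meaning here.\<close>

definition finsupp_module :: "('k, 'a, 'n) module_scheme \<Rightarrow> ('k, 'i \<Rightarrow> 'a) module" where
  "finsupp_module M =
    \<lparr>carrier = {w. (\<forall>i. w i \<in> carrier M) \<and> finite {i. w i \<noteq> \<zero>\<^bsub>M\<^esub>}},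
     monoid.mult = undefined, one = undefined, ring.zero = (\<lambda>i. \<zero>\<^bsub>M\<^esub>),
     ring.add = (\<lambda>v w i. v i \<oplus>\<^bsub>M\<^esub> w i), smult = (\<lambda>c w i. c \<odot>\<^bsub>M\<^esub> w i)\<rparr>"

lemma finsupp_module_simps:
  "w \<in> carrier (finsupp_module M) \<longleftrightarrow> (\<forall>i. w i \<in> carrier M) \<and> finite {i. w i \<noteq> \<zero>\<^bsub>M\<^esub>}"
  "\<zero>\<^bsub>finsupp_module M\<^esub> = (\<lambda>i. \<zero>\<^bsub>M\<^esub>)"
  "v \<oplus>\<^bsub>finsupp_module M\<^esub> w = (\<lambda>i. v i \<oplus>\<^bsub>M\<^esub> w i)"
  "c \<odot>\<^bsub>finsupp_module M\<^esub> w = (\<lambda>i. c \<odot>\<^bsub>M\<^esub> w i)"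
  by (simp_all add: finsupp_module_def)

lemma (in module) finsupp_module_map_closed:
  assumes "w \<in> carrier (finsupp_module M)" and "\<And>x. x \<in> carrier M \<Longrightarrow> t x \<in> carrier M"
    and "t \<zero>\<^bsub>M\<^esub> = \<zero>\<^bsub>M\<^esub>"
  shows "(\<lambda>i. t (w i)) \<in> carrier (finsupp_module M)"
proof -
  have "{i. t (w i) \<noteq> \<zero>\<^bsub>M\<^esub>} \<subseteq> {i. w i \<noteq> \<zero>\<^bsub>M\<^esub>}" using assms(3) by auto
  then show ?thesis
    using assms finite_subset by (auto simp: finsupp_module_simps)
qed

lemma (in module) finsupp_module_add_closed:
  assumes "v \<in> carrier (finsupp_module M)" "w \<in> carrier (finsupp_module M)"
  shows "(\<lambda>i. v i \<oplus>\<^bsub>M\<^esub> w i) \<in> carrier (finsupp_module M)"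
proof -
  have "{i. v i \<oplus>\<^bsub>M\<^esub> w i \<noteq> \<zero>\<^bsub>M\<^esub>} \<subseteq> {i. v i \<noteq> \<zero>\<^bsub>M\<^esub>} \<union> {i. w i \<noteq> \<zero>\<^bsub>M\<^esub>}" by auto
  then show ?thesis
    using assms finite_subset[OF _ finite_UnI] by (auto simp: finsupp_module_simps)
qed

lemma (in module) finsupp_module_is_module: "module R (finsupp_module M :: ('a, 'i \<Rightarrow> 'c) module)"
proof (rule moduleI[OF R.is_cring])
  let ?V = "finsupp_module M :: ('a, 'i \<Rightarrow> 'c) module"
  have c: "w i \<in> carrier M" if "w \<in> carrier ?V" for w i
    using that by (simp add: finsupp_module_simps)
  note s = finsupp_module_simps(2-4)
  show "abelian_group ?V"
  proof (rule abelian_groupI)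
    fix w assume w: "w \<in> carrier ?V"
    show "\<exists>v\<in>carrier ?V. v \<oplus>\<^bsub>?V\<^esub> w = \<zero>\<^bsub>?V\<^esub>"
      by (rule bexI[OF _ finsupp_module_map_closed[OF w, of "\<lambda>x. \<ominus>\<^bsub>M\<^esub> x"]])
        (simp_all add: s c[OF w] M.l_neg)
  next
    show "\<zero>\<^bsub>?V\<^esub> \<in> carrier ?V" by (simp add: finsupp_module_simps)
  qed (auto simp: s c M.a_ac finsupp_module_add_closed)
  fix a x assume "a \<in> carrier R" "x \<in> carrier ?V"
  then show "a \<odot>\<^bsub>?V\<^esub> x \<in> carrier ?V"
    using finsupp_module_map_closed[of x "\<lambda>x. a \<odot>\<^bsub>M\<^esub> x"] by (simp add: s)
qed (auto simp: finsupp_module_simps smult_l_distr smult_r_distr smult_assoc1)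

text \<open>Applied both to left multiplication by an element of the algebra and to the operations
  \<open>D\<close>. A linear \<open>t\<close> fixes zero and so cannot enlarge supports.\<close>

lemma (in module) finsupp_module_pointwise_endo:
  defines "V \<equiv> finsupp_module M :: ('a, 'i \<Rightarrow> 'c) module"
  assumes "\<And>x. x \<in> carrier M \<Longrightarrow> t x \<in> carrier M"
    and "\<And>x y. \<lbrakk>x \<in> carrier M; y \<in> carrier M\<rbrakk> \<Longrightarrow> t (x \<oplus>\<^bsub>M\<^esub> y) = t x \<oplus>\<^bsub>M\<^esub> t y"
    and "\<And>c x. \<lbrakk>c \<in> carrier R; x \<in> carrier M\<rbrakk> \<Longrightarrow> t (c \<odot>\<^bsub>M\<^esub> x) = c \<odot>\<^bsub>M\<^esub> t x"
  shows "(\<lambda>w\<in>carrier V. \<lambda>i. t (w i)) \<in> linear_endos R V"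
proof -
  interpret V: module R V unfolding V_def by (rule finsupp_module_is_module)
  have "t \<zero>\<^bsub>M\<^esub> = \<zero>\<^bsub>M\<^esub>"
    using assms(4)[of \<zero> "\<zero>\<^bsub>M\<^esub>"] assms(2)[of "\<zero>\<^bsub>M\<^esub>"] by simp
  have cl: "(\<lambda>i. t (w i)) \<in> carrier V" if "w \<in> carrier V" for w
    using finsupp_module_map_closed[of w t] \<open>t \<zero>\<^bsub>M\<^esub> = \<zero>\<^bsub>M\<^esub>\<close> assms(2) that unfolding V_def by blast
  show ?thesis
  proof (rule linear_endosI)
    fix v w assume v: "v \<in> carrier V" and w: "w \<in> carrier V"
    then show "(\<lambda>w\<in>carrier V. \<lambda>i. t (w i)) (v \<oplus>\<^bsub>V\<^esub> w) =
      (\<lambda>w\<in>carrier V. \<lambda>i. t (w i)) v \<oplus>\<^bsub>V\<^esub>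
      (\<lambda>w\<in>carrier V. \<lambda>i. t (w i)) w"
      using V.M.a_closed[OF v w] assms(3) by (simp add: V_def finsupp_module_simps)
  next
    fix c and w assume c: "c \<in> carrier R" and w: "w \<in> carrier V"
    then show "(\<lambda>w\<in>carrier V. \<lambda>i. t (w i)) (c \<odot>\<^bsub>V\<^esub> w) =
      c \<odot>\<^bsub>V\<^esub> (\<lambda>w\<in>carrier V. \<lambda>i. t (w i)) w"
      using V.smult_closed[OF c w] assms(4) by (simp add: V_def finsupp_module_simps)
  qed (simp_all add: cl)
qed

lemma (in module) finsupp_module_single:
  assumes "b \<in> carrier M"
  shows "(\<lambda>i. if i = j then b else \<zero>\<^bsub>M\<^esub>) \<in> carrier (finsupp_module M)"
proof -
  have "{i. (if i = j then b else \<zero>\<^bsub>M\<^esub>) \<noteq> \<zero>\<^bsub>M\<^esub>} \<subseteq> {j}" by auto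
  then have "finite {i. (if i = j then b else \<zero>\<^bsub>M\<^esub>) \<noteq> \<zero>\<^bsub>M\<^esub>}"
    by (rule finite_subset) simp
  then show ?thesis using assms by (auto simp: finsupp_module_simps)
qed

text \<open>Here \<open>c\<close> turns every vector into an index of its own, so that prescribing the values of an
  endomorphism on the indices suffices to reach every vector.\<close>

lemma (in module) finsupp_module_indexed_endo:
  fixes c :: "('i \<Rightarrow> 'c) \<Rightarrow> 'i"
  defines "V \<equiv> finsupp_module M :: ('a, 'i \<Rightarrow> 'c) module"
  assumes inj: "inj_on c (carrier V)"
    and \<phi>: "\<phi> \<in> carrier M \<rightarrow> carrier R"
    and \<phi>_add: "\<And>x y. \<lbrakk>x \<in> carrier M; y \<in> carrier M\<rbrakk> \<Longrightarrow> \<phi> (x \<oplus>\<^bsub>M\<^esub> y) = \<phi> x \<oplus> \<phi> y"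
    and \<phi>_smult: "\<And>c x. \<lbrakk>c \<in> carrier R; x \<in> carrier M\<rbrakk> \<Longrightarrow> \<phi> (c \<odot>\<^bsub>M\<^esub> x) = c \<otimes> \<phi> x"
  obtains T where "T \<in> linear_endos R V"
    and "\<And>v b. \<lbrakk>v \<in> carrier V; b \<in> carrier M\<rbrakk> \<Longrightarrow>
      T (\<lambda>i. if i = c v then b else \<zero>\<^bsub>M\<^esub>) = \<phi> b \<odot>\<^bsub>V\<^esub> v"
proof -
  interpret V: module R V unfolding V_def by (rule finsupp_module_is_module)
  have \<phi>c: "\<phi> x \<in> carrier R" if "x \<in> carrier M" for x using \<phi> that by auto
  have \<phi>0: "\<phi> \<zero>\<^bsub>M\<^esub> = \<zero>"
    using \<phi>_smult[of \<zero> "\<zero>\<^bsub>M\<^esub>"] \<phi>c[of "\<zero>\<^bsub>M\<^esub>"] by simp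
  have wc: "w i \<in> carrier M" if "w \<in> carrier V" for w i
    using that by (simp add: V_def finsupp_module_simps)
  \<comment> \<open>A set of vectors, not of indices: those whose own index lies in the support of
    \<open>w\<close>. Injectivity of \<open>c\<close> makes it finite.\<close>
  define supp where "supp w = {v \<in> carrier V. w (c v) \<noteq> \<zero>\<^bsub>M\<^esub>}" for w :: "'i \<Rightarrow> 'c"
  have fin: "finite (supp w)" if "w \<in> carrier V" for w
  proof (rule finite_imageD)
    show "finite (c ` supp w)"
      by (rule finite_subset[of _ "{i. w i \<noteq> \<zero>\<^bsub>M\<^esub>}"])
        (use that in \<open>auto simp: supp_def V_def finsupp_module_simps\<close>)
    show "inj_on c (supp w)"
      by (rule inj_on_subset[OF inj]) (auto simp: supp_def)
  qed
  \<comment> \<open>The entry of \<open>w\<close> at the index of \<open>v\<close> is turned by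
    \<open>\<phi>\<close> into the coefficient of \<open>v\<close>.\<close>
  define T where "T = (\<lambda>w\<in>carrier V. \<Oplus>\<^bsub>V\<^esub>v\<in>supp w. \<phi> (w (c v)) \<odot>\<^bsub>V\<^esub> v)"
  have summand: "(\<lambda>v. \<phi> (w (c v)) \<odot>\<^bsub>V\<^esub> v) \<in> F \<rightarrow> carrier V"
    if "w \<in> carrier V" "F \<subseteq> carrier V" for w F
    using that wc \<phi>c by auto
  \<comment> \<open>Summing over any larger finite set gives the same result, so sums and multiples
    can be compared over a common range although their supports may shrink.\<close>
  have T: "T w = (\<Oplus>\<^bsub>V\<^esub>v\<in>F. \<phi> (w (c v)) \<odot>\<^bsub>V\<^esub> v)"
    if w: "w \<in> carrier V" and F: "finite F" "supp w \<subseteq> F" "F \<subseteq> carrier V" for w F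
  proof -
    have "(\<Oplus>\<^bsub>V\<^esub>v\<in>supp w. \<phi> (w (c v)) \<odot>\<^bsub>V\<^esub> v) = (\<Oplus>\<^bsub>V\<^esub>v\<in>F. \<phi> (w (c v)) \<odot>\<^bsub>V\<^esub> v)"
    proof (rule V.M.add.finprod_mono_neutral_cong_left[OF F(1,2)])
      show "\<phi> (w (c v)) \<odot>\<^bsub>V\<^esub> v = \<zero>\<^bsub>V\<^esub>" if "v \<in> F - supp w" for v
        using that F(3) \<phi>0 by (auto simp: supp_def)
      show "(\<lambda>v. \<phi> (w (c v)) \<odot>\<^bsub>V\<^esub> v) \<in> F \<rightarrow> carrier V"
        using summand[OF w F(3)] .
    qed simp
    then show ?thesis using w by (simp add: T_def)
  qed
  have Tc: "T w \<in> carrier V" if w: "w \<in> carrier V" for w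
    using V.M.finsum_closed[OF summand[OF w, of "supp w"]] w by (auto simp: T_def supp_def)
  have "T \<in> linear_endos R V"
  proof (rule linear_endosI)
    fix u w assume u: "u \<in> carrier V" and w: "w \<in> carrier V"
    define F where "F = supp u \<union> supp w"
    have F: "finite F" "F \<subseteq> carrier V" "supp u \<subseteq> F" "supp w \<subseteq> F"
      using fin u w by (auto simp: F_def supp_def)
    have uw: "u \<oplus>\<^bsub>V\<^esub> w = (\<lambda>i. u i \<oplus>\<^bsub>M\<^esub> w i)" by (simp add: V_def finsupp_module_simps)
    have "supp (u \<oplus>\<^bsub>V\<^esub> w) \<subseteq> F"
      unfolding uw F_def supp_def by auto
    then have "T (u \<oplus>\<^bsub>V\<^esub> w) = (\<Oplus>\<^bsub>V\<^esub>v\<in>F. \<phi> ((u \<oplus>\<^bsub>V\<^esub> w) (c v)) \<odot>\<^bsub>V\<^esub> v)"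
      by (rule T[OF V.M.a_closed[OF u w] F(1) _ F(2)])
    also have "\<dots> = (\<Oplus>\<^bsub>V\<^esub>v\<in>F. \<phi> (u (c v)) \<odot>\<^bsub>V\<^esub> v \<oplus>\<^bsub>V\<^esub> \<phi> (w (c v)) \<odot>\<^bsub>V\<^esub> v)"
    proof (rule V.M.finsum_cong')
      fix v assume "v \<in> F"
      then have "v \<in> carrier V" using F by auto
      then show "\<phi> ((u \<oplus>\<^bsub>V\<^esub> w) (c v)) \<odot>\<^bsub>V\<^esub> v = \<phi> (u (c v)) \<odot>\<^bsub>V\<^esub> v \<oplus>\<^bsub>V\<^esub> \<phi> (w (c v)) \<odot>\<^bsub>V\<^esub> v"
        unfolding uw using u w wc by (simp add: \<phi>_add \<phi>c V.smult_l_distr)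
    qed (use F u w wc \<phi>c in auto)
    also have "\<dots> = T u \<oplus>\<^bsub>V\<^esub> T w"
      using V.M.finsum_addf[OF summand[OF u F(2)] summand[OF w F(2)]] T[OF u F(1,3,2)] T[OF w F(1,4,2)] by simp
    finally show "T (u \<oplus>\<^bsub>V\<^esub> w) = T u \<oplus>\<^bsub>V\<^esub> T w" .
  next
    fix a w assume a: "a \<in> carrier R" and w: "w \<in> carrier V"
    have F: "finite (supp w)" "supp w \<subseteq> carrier V" using fin[OF w] by (auto simp: supp_def)
    have aw: "a \<odot>\<^bsub>V\<^esub> w = (\<lambda>i. a \<odot>\<^bsub>M\<^esub> w i)" by (simp add: V_def finsupp_module_simps)
    have "supp (a \<odot>\<^bsub>V\<^esub> w) \<subseteq> supp w"
      unfolding aw supp_def using a by auto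
    then have "T (a \<odot>\<^bsub>V\<^esub> w) = (\<Oplus>\<^bsub>V\<^esub>v\<in>supp w. \<phi> ((a \<odot>\<^bsub>V\<^esub> w) (c v)) \<odot>\<^bsub>V\<^esub> v)"
      by (rule T[OF V.smult_closed[OF a w] F(1) _ F(2)])
    also have "\<dots> = (\<Oplus>\<^bsub>V\<^esub>v\<in>supp w. a \<odot>\<^bsub>V\<^esub> (\<phi> (w (c v)) \<odot>\<^bsub>V\<^esub> v))"
    proof (rule V.M.finsum_cong')
      fix v assume "v \<in> supp w"
      then have "v \<in> carrier V" using F by auto
      then show "\<phi> ((a \<odot>\<^bsub>V\<^esub> w) (c v)) \<odot>\<^bsub>V\<^esub> v = a \<odot>\<^bsub>V\<^esub> (\<phi> (w (c v)) \<odot>\<^bsub>V\<^esub> v)"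
        unfolding aw using a w wc by (simp add: \<phi>_smult \<phi>c V.smult_assoc1)
    qed (use F a w wc \<phi>c in auto)
    also have "\<dots> = a \<odot>\<^bsub>V\<^esub> T w"
      using V.finsum_smult_ldistr[OF F(1) a summand[OF w F(2)]] w by (simp add: T_def)
    finally show "T (a \<odot>\<^bsub>V\<^esub> w) = a \<odot>\<^bsub>V\<^esub> T w" .
  qed (use Tc in \<open>simp_all add: T_def\<close>)
  moreover have "T (\<lambda>i. if i = c v then b else \<zero>\<^bsub>M\<^esub>) = \<phi> b \<odot>\<^bsub>V\<^esub> v"
    if v: "v \<in> carrier V" and b: "b \<in> carrier M" for v b
  proof -
    let ?w = "\<lambda>i. if i = c v then b else \<zero>\<^bsub>M\<^esub>"
    have "?w \<in> carrier V" unfolding V_def by (rule finsupp_module_single[OF b])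
    \<comment> \<open>Because \<open>c\<close> is injective, no other vector has the index
      \<open>c v\<close>.\<close>
    moreover have "supp ?w \<subseteq> {v}"
      using v inj by (auto simp: supp_def inj_on_eq_iff split: if_splits)
    ultimately have "T ?w = (\<Oplus>\<^bsub>V\<^esub>u\<in>{v}. \<phi> (?w (c u)) \<odot>\<^bsub>V\<^esub> u)"
      using v by (intro T) simp_all
    also have "\<dots> = \<phi> b \<odot>\<^bsub>V\<^esub> v"
      using v b \<phi>c by simp
    finally show ?thesis .
  qed
  ultimately show thesis by (rule that)
qed

section \<open>The embedding\<close>

lemma D_hom_comp:
  assumes "g \<in> D_hom K Ds A B" and "h \<in> D_hom K Ds B C"
  shows "h \<circ> g \<in> D_hom K Ds A C"
  using assms ring_hom_trans[of g A B h C] ring_hom_closed[of g A B]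
  by (simp add: D_hom_def)

text \<open>With \<open>\<phi>\<close> normalized to 1 at \<open>a\<close>, some \<open>P\<close>
  makes the composite \<open>N\<close> of left multiplication by \<open>a\<close> followed by
  \<open>P\<close> surjective, and \<open>Q\<close> is a linear right inverse of \<open>N\<close>.
  This later forces 1 into every ideal containing left multiplication by \<open>a\<close>.\<close>

lemma (in assoc_algebra) left_mult_sandwich:
  fixes c :: "('i \<Rightarrow> 'c) \<Rightarrow> 'i"
  defines "V \<equiv> finsupp_module A :: ('a, 'i \<Rightarrow> 'c) module"
  assumes a: "a \<in> carrier A" "a \<noteq> \<zero>\<^bsub>A\<^esub>" and inj: "inj_on c (carrier V)"
  obtains P Q where "P \<in> linear_endos K V" "Q \<in> linear_endos K V"
    and "\<And>w. w \<in> carrier V \<Longrightarrow> P (\<lambda>i. a \<otimes>\<^bsub>A\<^esub> Q w i) = w"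
proof -
  interpret V: module K V unfolding V_def by (rule finsupp_module_is_module)
  obtain \<phi> where \<phi>: "\<phi> \<in> carrier A \<rightarrow> carrier K" and \<phi>a: "\<phi> a = \<one>"
    and lin: "\<And>x y. \<lbrakk>x \<in> carrier A; y \<in> carrier A\<rbrakk> \<Longrightarrow> \<phi> (x \<oplus>\<^bsub>A\<^esub> y) = \<phi> x \<oplus> \<phi> y"
      "\<And>c x. \<lbrakk>c \<in> carrier K; x \<in> carrier A\<rbrakk> \<Longrightarrow> \<phi> (c \<odot>\<^bsub>A\<^esub> x) = c \<otimes> \<phi> x"
    by (rule linear_functional_exists[OF field_axioms a]) (rule that)
  obtain P where P: "P \<in> linear_endos K V"
    and Xs: "\<And>v b. \<lbrakk>v \<in> carrier V; b \<in> carrier A\<rbrakk> \<Longrightarrow>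
      P (\<lambda>i. if i = c v then b else \<zero>\<^bsub>A\<^esub>) = \<phi> b \<odot>\<^bsub>V\<^esub> v"
    by (rule finsupp_module_indexed_endo[OF inj[unfolded V_def] \<phi>, folded V_def],
        (rule lin; assumption)+, rule that)
  define L where "L = (\<lambda>w\<in>carrier V. \<lambda>i. a \<otimes>\<^bsub>A\<^esub> w i)"
  have L: "L \<in> linear_endos K V"
    unfolding L_def V_def
    by (rule finsupp_module_pointwise_endo) (simp_all add: a A.r_distr smult_mult_right)
  define N where "N = compose (carrier V) P L"
  note XD = linear_endosD[OF P] and LD = linear_endosD[OF L]
  have N: "N \<in> linear_endos K V"
    by (rule linear_endosI) (simp_all add: N_def compose_def XD LD)
  have "carrier V \<subseteq> N ` carrier V"
  proof
    fix v assume v: "v \<in> carrier V"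
    \<comment> \<open>Left multiplication puts \<open>a\<close> at the index of \<open>v\<close>,
      and \<open>P\<close> then returns \<open>\<phi> a\<close> times \<open>v\<close>, which is
      \<open>v\<close>.\<close>
    let ?e = "\<lambda>i. if i = c v then \<one>\<^bsub>A\<^esub> else \<zero>\<^bsub>A\<^esub>"
    have e: "?e \<in> carrier V" unfolding V_def by (rule finsupp_module_single) simp
    have "L ?e = (\<lambda>i. if i = c v then a else \<zero>\<^bsub>A\<^esub>)"
      using e a by (auto simp: L_def)
    then have "N ?e = v" using e v a Xs \<phi>a by (simp add: N_def compose_def)
    then show "v \<in> N ` carrier V" using e by force
  qed
  from V.linear_section_exists[OF field_axioms N this]
  obtain Q where Q: "Q \<in> linear_endos K V" and NY: "\<And>x. x \<in> carrier V \<Longrightarrow> N (Q x) = x"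
    by blast
  have "P (\<lambda>i. a \<otimes>\<^bsub>A\<^esub> Q w i) = w" if "w \<in> carrier V" for w
    using NY[OF that] linear_endosD(1)[OF Q that] by (simp add: N_def compose_def L_def)
  then show thesis by (rule that[OF P Q])
qed

text \<open>Leibniz' rule says that left multiplication by \<open>D a\<close> is the commutator of \<open>D\<close> and left
  multiplication by \<open>a\<close>.\<close>

lemma (in D_algebra) left_mult_D_hom:
  defines "V \<equiv> finsupp_module A :: ('k, 'i \<Rightarrow> 'a) module"
  shows "(\<lambda>a. \<lambda>w\<in>carrier V. \<lambda>i. a \<otimes>\<^bsub>A\<^esub> w i) \<in>
    D_hom K Ds A (end_algebra K V (\<lambda>D. \<lambda>w\<in>carrier V. \<lambda>i. dop A D (w i)))"
proof -
  let ?L = "\<lambda>a. \<lambda>w\<in>carrier V. \<lambda>i. a \<otimes>\<^bsub>A\<^esub> w i"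
  interpret V: module K V unfolding V_def by (rule finsupp_module_is_module)
  have L: "?L a \<in> linear_endos K V" if "a \<in> carrier A" for a
    unfolding V_def
    by (rule finsupp_module_pointwise_endo) (simp_all add: that A.r_distr smult_mult_right)
  have \<delta>: "(\<lambda>w\<in>carrier V. \<lambda>i. dop A D (w i)) \<in> linear_endos K V" if "D \<in> Ds" for D
    unfolding V_def
    by (rule finsupp_module_pointwise_endo) (simp_all add: that dop_closed dop_add dop_smult)
  have w: "w i \<in> carrier A" if "w \<in> carrier V" for w i
    using that by (simp add: V_def finsupp_module_simps)
  have Lc: "(\<lambda>i. a \<otimes>\<^bsub>A\<^esub> w i) \<in> carrier V" if "a \<in> carrier A" "w \<in> carrier V" for a w
    using linear_endosD(1)[OF L[OF that(1)] that(2)] that(2) by simp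
  have Dc: "(\<lambda>i. dop A D (w i)) \<in> carrier V" if "D \<in> Ds" "w \<in> carrier V" for D w
    using linear_endosD(1)[OF \<delta>[OF that(1)] that(2)] that(2) by simp
  have comm: "dop A D (a \<otimes>\<^bsub>A\<^esub> x) \<oplus>\<^bsub>A\<^esub> \<ominus>\<^bsub>A\<^esub> (a \<otimes>\<^bsub>A\<^esub> dop A D x) = dop A D a \<otimes>\<^bsub>A\<^esub> x"
    if "D \<in> Ds" "a \<in> carrier A" "x \<in> carrier A" for D a x
    using that by (simp add: dop_mult dop_closed M.a_assoc M.r_neg)
  \<comment> \<open>Negation in \<open>V\<close> is given only as an inverse in the additive group;
    writing it as the scalar -1 makes it pointwise.\<close>
  have minus: "\<ominus>\<^bsub>V\<^esub> u = (\<lambda>i. \<ominus>\<^bsub>A\<^esub> u i)" if "u \<in> carrier V" for u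
  proof -
    have "(\<ominus> \<one>) \<odot>\<^bsub>V\<^esub> u = \<ominus>\<^bsub>V\<^esub> u" using that by (simp add: V.smult_l_minus)
    moreover have "(\<ominus> \<one>) \<odot>\<^bsub>V\<^esub> u = (\<lambda>i. \<ominus>\<^bsub>A\<^esub> u i)"
      using w[OF that] by (simp add: V_def finsupp_module_simps smult_l_minus)
    ultimately show ?thesis by simp
  qed
  have plus: "u \<oplus>\<^bsub>V\<^esub> v = (\<lambda>i. u i \<oplus>\<^bsub>A\<^esub> v i)" and sm: "c \<odot>\<^bsub>V\<^esub> v = (\<lambda>i. c \<odot>\<^bsub>A\<^esub> v i)" for u v c
    by (simp_all add: V_def finsupp_module_simps)
  show ?thesis
    unfolding D_hom_def ring_hom_def
    by (auto simp: end_algebra_def L Lc Dc w compose_def plus sm minus comm a_minus_def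
        A.m_assoc A.l_distr smult_mult_left fun_eq_iff)
qed

theorem theorem5p2:
  fixes K :: "('k, 'm) ring_scheme"
    and Ds :: "'d set"
    and A :: "('k, 'a, 'd) diff_algebra"
  assumes "field K"
    and "D_algebra K Ds A"
    and "\<one>\<^bsub>A\<^esub> \<noteq> \<zero>\<^bsub>A\<^esub>"
  shows "\<exists>(S :: ('k, ('a, 'd) ext, 'd) diff_algebra) h.
           simple_D_algebra K Ds S \<and> h \<in> D_hom K Ds A S \<and> inj_on h (carrier A)"
proof -
  interpret A: D_algebra K Ds A by fact
  \<comment> \<open>The two distinct letters required by both encodings are 1 and 0 of
    \<open>A\<close>.\<close>
  obtain enc :: "'a list list \<Rightarrow> 'a list" where enc: "inj enc"
    using inj_list_list_encoding[OF assms(3)] .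
  obtain c :: "('a list \<Rightarrow> 'a) \<Rightarrow> 'a list" where c: "inj_on c {w. finite {i. w i \<noteq> \<zero>\<^bsub>A\<^esub>}}"
    using inj_finite_support_encoding[OF assms(3)] .
  \<comment> \<open>With words as indices, \<open>c\<close> assigns to each vector of
    \<open>V\<close> an index of its own.\<close>
  define V :: "('k, 'a list \<Rightarrow> 'a) module" where "V = finsupp_module A"
  interpret V: module K V unfolding V_def by (rule A.finsupp_module_is_module)
  have c: "inj_on c (carrier V)"
    by (rule inj_on_subset[OF c]) (auto simp: V_def finsupp_module_simps)
  define \<delta> where "\<delta> = (\<lambda>D. \<lambda>w\<in>carrier V. \<lambda>i. dop A D (w i))"
  have \<delta>: "\<delta> D \<in> linear_endos K V" if "D \<in> Ds" for D
    unfolding V_def \<delta>_def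
    by (rule A.finsupp_module_pointwise_endo)
      (simp_all add: that A.dop_closed A.dop_add A.dop_smult)
  define E where "E = end_algebra K V \<delta>"
  have D_E: "D_algebra K Ds E"
    unfolding E_def by (rule V.end_algebra_D_algebra[OF assms(1)], rule \<delta>)
  interpret E: D_algebra K Ds E by (rule D_E)
  have carr: "carrier E = linear_endos K V" by (simp add: E_def end_algebra_def)
  define L where "L = (\<lambda>a. \<lambda>w\<in>carrier V. \<lambda>i. a \<otimes>\<^bsub>A\<^esub> w i)"
  have L: "L \<in> D_hom K Ds A E"
    unfolding L_def E_def \<delta>_def V_def by (rule A.left_mult_D_hom)
  interpret L: ring_hom_ring A E L
    by (rule ring_hom_ringI2[OF A.A.ring_axioms E.A.ring_axioms]) (use L in \<open>simp add: D_hom_def\<close>)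
  \<comment> \<open>Identity and zero operator differ on a nonzero vector; the index
    \<open>[]\<close> of its only nonzero entry is an arbitrary choice.\<close>
  have "\<one>\<^bsub>E\<^esub> \<noteq> \<zero>\<^bsub>E\<^esub>"
  proof
    let ?e = "\<lambda>i. if i = [] then \<one>\<^bsub>A\<^esub> else \<zero>\<^bsub>A\<^esub>"
    assume "\<one>\<^bsub>E\<^esub> = \<zero>\<^bsub>E\<^esub>"
    have e: "?e \<in> carrier V"
      unfolding V_def by (rule A.finsupp_module_single) simp
    have "\<one>\<^bsub>E\<^esub> ?e = ?e" "\<zero>\<^bsub>E\<^esub> ?e = \<zero>\<^bsub>V\<^esub>"
      using e by (simp_all add: E_def end_algebra_def)
    then have "?e = \<zero>\<^bsub>V\<^esub>" using \<open>\<one>\<^bsub>E\<^esub> = \<zero>\<^bsub>E\<^esub>\<close> by simp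
    from fun_cong[OF this, of "[]"] have "\<one>\<^bsub>A\<^esub> = \<zero>\<^bsub>A\<^esub>"
      by (simp add: V_def finsupp_module_simps)
    then show False using assms(3) by simp
  qed
  then obtain M where max: "maximalideal M E"
    using E.A.maximalideal_exists by blast
  interpret M: maximalideal M E by (rule max)
  \<comment> \<open>For nonzero \<open>a\<close> the sandwich of \<open>L a\<close> between
    \<open>P\<close> and \<open>Q\<close> is 1 and would lie in the proper ideal
    \<open>M\<close>.\<close>
  have LM: "a = \<zero>\<^bsub>A\<^esub>" if a: "a \<in> carrier A" and "L a \<in> M" for a
  proof (rule ccontr)
    assume a0: "a \<noteq> \<zero>\<^bsub>A\<^esub>"
    obtain P Q where P: "P \<in> linear_endos K V" and Q: "Q \<in> linear_endos K V"
      and XY: "\<And>w. w \<in> carrier V \<Longrightarrow> P (\<lambda>i. a \<otimes>\<^bsub>A\<^esub> Q w i) = w"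
      by (rule A.left_mult_sandwich[OF a a0 c[unfolded V_def], folded V_def]) (rule that)
    have "P \<otimes>\<^bsub>E\<^esub> (L a \<otimes>\<^bsub>E\<^esub> Q) = \<one>\<^bsub>E\<^esub>"
      using linear_endosD(1)[OF Q] XY
      by (simp add: E_def end_algebra_def compose_def L_def restrict_def fun_eq_iff)
    moreover have "P \<otimes>\<^bsub>E\<^esub> (L a \<otimes>\<^bsub>E\<^esub> Q) \<in> M"
      using P Q \<open>L a \<in> M\<close> by (simp add: carr M.I_l_closed M.I_r_closed)
    ultimately show False using M.one_imp_carrier M.I_notcarr by simp
  qed
  have dM: "dop E D T \<in> M" if D: "D \<in> Ds" and T: "T \<in> M" for D T
  proof -
    have Tc: "T \<in> carrier E" using M.Icarr[OF T] .
    have \<delta>c: "\<delta> D \<in> carrier E" using \<delta>[OF D] by (simp add: carr)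
    note l = linear_endosD(1)[OF \<delta>[OF D]] linear_endosD(1)[OF Tc[unfolded carr]]
    \<comment> \<open>The derivation is inner because \<open>\<delta> D\<close> belongs to
      \<open>E\<close>. Stated without subtraction, the identity can be checked pointwise without
      computing negatives of operators.\<close>
    have "dop E D T \<oplus>\<^bsub>E\<^esub> T \<otimes>\<^bsub>E\<^esub> \<delta> D = \<delta> D \<otimes>\<^bsub>E\<^esub> T"
      by (auto simp: E_def end_algebra_def compose_def fun_eq_iff restrict_def l a_minus_def
          V.M.a_assoc V.M.l_neg)
    then have "dop E D T = \<delta> D \<otimes>\<^bsub>E\<^esub> T \<ominus>\<^bsub>E\<^esub> T \<otimes>\<^bsub>E\<^esub> \<delta> D"
      using E.dop_closed[OF D Tc] Tc \<delta>c
      by (metis E.A.m_closed E.M.add.inv_solve_right a_minus_def)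
    then show ?thesis
      using T \<delta>c Tc by (simp add: M.I_l_closed M.I_r_closed a_minus_def)
  qed
  \<comment> \<open>An operator is recorded by its graph: each pair of a vector and its image
    becomes one word, so the graph is a set of words. This carries the quotient into the required
    type.\<close>
  define \<iota> :: "(('a list \<Rightarrow> 'a) \<Rightarrow> ('a list \<Rightarrow> 'a)) \<Rightarrow> ('a, 'd) ext"
    where "\<iota> T = (\<lambda>v. map Inl (enc [c v, c (T v)])) ` carrier V" for T
  have "inj_on \<iota> (carrier E)"
  proof (rule inj_onI)
    fix S T assume S: "S \<in> carrier E" and T: "T \<in> carrier E" and eq: "\<iota> S = \<iota> T"
    note S = S[unfolded carr] and T = T[unfolded carr]
    have "S v = T v" if v: "v \<in> carrier V" for v
    proof -
      have "map Inl (enc [c v, c (S v)]) \<in> \<iota> S"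
        using v unfolding \<iota>_def by blast
      then have "map Inl (enc [c v, c (S v)]) \<in> \<iota> T" by (simp add: eq)
      then obtain u where u: "u \<in> carrier V"
        and "map Inl (enc [c v, c (S v)]) = (map Inl (enc [c u, c (T u)]) :: ('a + 'd) list)"
        unfolding \<iota>_def by blast
      then have "enc [c v, c (S v)] = enc [c u, c (T u)]"
        by (simp add: inj_map_eq_map)
      then have "c v = c u" "c (S v) = c (T u)"
        using injD[OF enc] by blast+
      then show ?thesis
        using u v c linear_endosD(1)[OF S] linear_endosD(1)[OF T] by (metis inj_on_eq_iff)
    qed
    then show "S = T"
      using linear_endosD(4)[OF S] linear_endosD(4)[OF T] by (blast intro: extensionalityI)
  qed
  then obtain f :: "_ \<Rightarrow> ('a, 'd) ext" where f: "weak_ring_morphism f M E"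
    using E.A.weak_ring_morphism_exists[OF M.is_ideal] by blast
  let ?S = "image_diff_algebra f E"
  have "simple_D_algebra K Ds ?S"
    by (rule simple_image_maximalideal[OF D_E f max dM])
  moreover have "f \<circ> L \<in> D_hom K Ds A ?S"
    by (rule D_hom_comp[OF L D_algebra_image(2)[OF D_E f dM]])
  \<comment> \<open>Elements with equal images have a difference that \<open>L\<close> sends into
    \<open>M\<close>, and \<open>LM\<close> makes this difference zero.\<close>
  moreover have "inj_on (f \<circ> L) (carrier A)"
  proof (rule inj_onI)
    fix a b assume ab: "a \<in> carrier A" "b \<in> carrier A" and "(f \<circ> L) a = (f \<circ> L) b"
    then have "L a \<ominus>\<^bsub>E\<^esub> L b \<in> M"
      using weak_ring_morphism.inj_mod_ideal[OF f] by simp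
    then have "L (a \<ominus>\<^bsub>A\<^esub> b) \<in> M"
      using ab by (simp add: a_minus_def)
    then have "a \<ominus>\<^bsub>A\<^esub> b = \<zero>\<^bsub>A\<^esub>" using ab LM by simp
    then show "a = b" using ab by simp
  qed
  ultimately show ?thesis by blast
qed

end
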